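(* Let $d\ge 3$ be a fixed integer, let $c_n\to c\in\mathbb{R}$ and $p=(d-1)!\,\dfrac{\ln n+c_n}{n^{d-1}}$. Then w.h.p. $H_d(n,p)$ has a weak cycle spanning all non-isolated vertices (i.e. whose set of spanned vertices is exactly the set of non-isolated vertices of $H_d(n,p)$).
   Context: A $d$-uniform hypergraph is a pair $(V,E)$ with $E\subseteq\binom{V}{d}$; elements of $E$ are called edges. $H_d(n,p)$ is the random $d$-uniform hypergraph on $[n]=\{1,\dots,n\}$ in which each of the $\binom nd$ potential edges is present with probability $p$, independently. A vertex is isolated if it is contained in no edge. A weak (Berge) cycle of length $\ell\ge 3$ is an alternating sequence $(v_0,e_1,v_1,\dots,e_\ell,v_\ell=v_0)$ of vertices and edges such that $v_0,\dots,v_{\ell-1}$ are distinct and $v_{i-1},v_i\in e_i$ for each $i$; the edges need not be distinct. It spans the vertices $v_0,\dots,v_{\ell-1}$ (the edges may contain further vertices). "W.h.p." means with probability tending to $1$ as $n\to\infty$. *)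

theory Defs
  imports "HOL-Probability.Probability" "HOL-Probability.Product_PMF" "HOL-Library.Ramsey"
begin

type_synonym 'a hypergraph = "'a set \<times> 'a set set"

definition verts :: "'a hypergraph \<Rightarrow> 'a set" where
  "verts H = fst H"

definition hedges :: "'a hypergraph \<Rightarrow> 'a set set" where
  "hedges H = snd H"

definition uniform_hypergraph :: "nat \<Rightarrow> 'a hypergraph \<Rightarrow> bool" where
  "uniform_hypergraph d H \<longleftrightarrow> hedges H \<subseteq> nsets (verts H) d"

definition isolated_vertex :: "'a hypergraph \<Rightarrow> 'a \<Rightarrow> bool" where
  "isolated_vertex H x \<longleftrightarrow> x \<in> verts H \<and> (\<forall>e\<in>hedges H. x \<notin> e)"

definition non_isolated :: "'a hypergraph \<Rightarrow> 'a set" where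
  "non_isolated H = {x \<in> verts H. \<not> isolated_vertex H x}"

text \<open>
  The cycle \<open>(v 0, e 1, v 1, \<dots>, e l, v l = v 0)\<close>; the values of \<open>v\<close> beyond \<open>l\<close>
  and of \<open>e\<close> outside \<open>{1..l}\<close> are irrelevant. The edges may repeat.
\<close>
definition weak_cycle :: "'a hypergraph \<Rightarrow> nat \<Rightarrow> (nat \<Rightarrow> 'a) \<Rightarrow> (nat \<Rightarrow> 'a set) \<Rightarrow> bool" where
  "weak_cycle H l v e \<longleftrightarrow>
     l \<ge> 3 \<and> v l = v 0 \<and> inj_on v {..<l} \<and> v ` {..<l} \<subseteq> verts H \<and>
     (\<forall>i\<in>{1..l}. e i \<in> hedges H \<and> v (i - 1) \<in> e i \<and> v i \<in> e i)"

definition spanned_vertices :: "nat \<Rightarrow> (nat \<Rightarrow> 'a) \<Rightarrow> 'a set" where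
  "spanned_vertices l v = v ` {..<l}"

text \<open>
  The library truncates the parameter of \<^const>\<open>bernoulli_pmf\<close> to the interval \<open>[0, 1]\<close>,
  so the model is total in \<open>p\<close>.
\<close>
definition random_hypergraph :: "nat \<Rightarrow> nat \<Rightarrow> real \<Rightarrow> nat hypergraph pmf" where
  "random_hypergraph d n p =
     map_pmf (\<lambda>X. ({1..n}, {e \<in> nsets {1..n} d. X e}))
       (Pi_pmf (nsets {1..n} d) False (\<lambda>_. bernoulli_pmf p))"

lemma uniform_random_hypergraph:
  assumes "H \<in> set_pmf (random_hypergraph d n p)"
  shows "verts H = {1..n}" and "uniform_hypergraph d H"
  using assms
  by (auto simp: random_hypergraph_def uniform_hypergraph_def verts_def hedges_def)

end

theory Submission
  imports Defs "HOL-Real_Asymp.Real_Asymp"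
begin

text \<open>
  Edges may repeat in a weak cycle, so a weak cycle spanning all non-isolated vertices is the
  same thing as a Hamilton cycle of the \<^emph>\<open>shadow graph\<close>, in which two vertices are adjacent when
  some edge contains both, on the union of the edges. For such Hamilton cycles there is the
  rotation method of Posa.

  \<^bold>\<open>Rotations.\<close> Suppose that in a connected graph every set \<open>S\<close> of at most \<open>k\<close> vertices has at
  least \<open>2 |S|\<close> outside neighbours. Rotating a longest path with one end fixed yields more than
  \<open>k\<close> other ends (\<open>posa_rotation\<close>), so at least \<open>k\<^sup>2\<close> ordered pairs are the two ends of some
  longest path (\<open>card_far_ends\<close>). An edge on such a pair closes the path to a cycle, and by
  connectivity the cycle is Hamiltonian, as otherwise it would open up to a longer path
  (\<open>closing_longest_path\<close>).

  \<^bold>\<open>A union bound over sparse certificates.\<close> Let \<open>H\<close> be the random hypergraph. The potential edges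
  are split by the parity of their vertex sum; as \<open>d \<ge> 3\<close>, every pair of vertices lies in order
  \<open>n ^ (d - 2)\<close> potential edges of either parity. With high probability, if the shadow of \<open>H\<close> is
  not Hamiltonian, then \<open>H\<close> contains a set \<open>F\<close> of only \<open>O(n)\<close> edges with the following property: the
  even edges of \<open>H\<close> together with \<open>F\<close> form a hypergraph whose shadow expands, is connected, and
  contains a longest path of the shadow of \<open>H\<close>. With \<open>k = n div 4\<close> it has order \<open>n\<^sup>2\<close> pairs of ends,
  and no edge of \<open>H\<close> contains any of them (\<open>weak_cycle_or_missing_boosters\<close>). So \<open>H\<close> avoids order
  \<open>n\<^sup>d\<close> odd potential edges, which has probability \<open>exp (- \<Omega> (n ln n))\<close>, whereas the sum of
  \<open>p ^ |F|\<close> over the possible sets \<open>F\<close> is only \<open>exp (O (n ln (ln n)))\<close>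
  (\<open>prob_sparse_certificate\<close>, \<open>prob_missing_boosters\<close>). The even edges cost nothing, because one
  sums over their exact configuration.

  \<^bold>\<open>Expansion.\<close> The certificate \<open>F\<close> consists of a longest path and of up to \<open>21 d\<close> edges at each
  vertex. Three properties of \<open>H\<close>, each holding with high probability, make it expand. Sets of at
  most \<open>t\<close> vertices span few edges, so sets of vertices of degree at least \<open>21 d\<close> expand by a
  factor of 6 (\<open>high_degree_expansion\<close>). Vertices of smaller degree are far apart, and each brings
  its own two neighbours because an edge has at least three vertices (\<open>small_set_expansion\<close>). The
  even edges join any set of at least about \<open>t / 7\<close> vertices to any disjoint set of \<open>n / 4\<close> vertices, which takes
  care of all larger sets and of connectivity (\<open>expansion_and_connectivity\<close>). The first property
  wants \<open>t\<close> small and the third wants it large; \<open>t\<close> of order \<open>n / (ln n) powr (3 / 4)\<close> serves both.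
\<close>

section \<open>Rotations of longest paths\<close>

fun consec :: "'a list \<Rightarrow> 'a \<Rightarrow> 'a \<Rightarrow> bool" where
  "consec [] x y \<longleftrightarrow> False"
| "consec (z # zs) x y \<longleftrightarrow> zs \<noteq> [] \<and> x = z \<and> y = hd zs \<or> consec zs x y"

lemma consec_append:
  "consec (xs @ ys) x y \<longleftrightarrow>
     consec xs x y \<or> consec ys x y \<or> xs \<noteq> [] \<and> ys \<noteq> [] \<and> x = last xs \<and> y = hd ys"
  by (induction xs) auto

lemma consec_rev: "consec (rev xs) x y \<longleftrightarrow> consec xs y x"
  by (induction xs) (auto simp: consec_append hd_rev last_rev)

lemma consec_in_set: "consec xs x y \<Longrightarrow> x \<in> set xs \<and> y \<in> set xs"
  by (induction xs) auto

lemma consec_unique_next: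
  "distinct xs \<Longrightarrow> consec xs x y \<Longrightarrow> consec xs x z \<Longrightarrow> y = z"
  by (induction xs) (auto dest: consec_in_set)

lemma consec_unique_prev:
  "distinct xs \<Longrightarrow> consec xs y x \<Longrightarrow> consec xs z x \<Longrightarrow> y = z"
  using consec_unique_next[of "rev xs" x y z] by (simp add: consec_rev)

lemma consec_not_last: "distinct xs \<Longrightarrow> consec xs x y \<Longrightarrow> x \<noteq> last xs"
  by (induction xs) (auto dest: consec_in_set)

lemma ex_next: "x \<in> set xs \<Longrightarrow> x \<noteq> last xs \<Longrightarrow> \<exists>y. consec xs x y"
proof (induction xs)
  case (Cons a xs)
  then show ?case by (cases "xs = []") (auto simp del: split_paired_Ex)
qed simp

lemma ex_prev: "x \<in> set xs \<Longrightarrow> x \<noteq> hd xs \<Longrightarrow> \<exists>y. consec xs y x"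
  using ex_next[of x "rev xs"] by (cases "xs = []") (auto simp: consec_rev last_rev)

definition path_in :: "('a \<Rightarrow> 'a \<Rightarrow> bool) \<Rightarrow> 'a set \<Rightarrow> 'a list \<Rightarrow> bool" where
  "path_in r V xs \<longleftrightarrow> xs \<noteq> [] \<and> distinct xs \<and> set xs \<subseteq> V \<and> successively r xs"

definition longest_path :: "('a \<Rightarrow> 'a \<Rightarrow> bool) \<Rightarrow> 'a set \<Rightarrow> 'a list \<Rightarrow> bool" where
  "longest_path r V xs \<longleftrightarrow> path_in r V xs \<and> (\<forall>ys. path_in r V ys \<longrightarrow> length ys \<le> length xs)"

definition nbhd :: "('a \<Rightarrow> 'a \<Rightarrow> bool) \<Rightarrow> 'a set \<Rightarrow> 'a set \<Rightarrow> 'a set" where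
  "nbhd r V S = {y \<in> V - S. \<exists>x\<in>S. r x y}"

text \<open>
  Adding an edge on such a pair to a connected graph creates a Hamilton cycle or a longer path;
  these pairs are commonly called boosters.
\<close>
definition far_ends :: "('a \<Rightarrow> 'a \<Rightarrow> bool) \<Rightarrow> 'a set \<Rightarrow> ('a \<times> 'a) set" where
  "far_ends r V = {(u, v). u \<noteq> v \<and> (\<exists>q. longest_path r V q \<and> hd q = u \<and> last q = v)}"

lemma path_in_snoc:
  "path_in r V q \<Longrightarrow> r (last q) x \<Longrightarrow> x \<in> V \<Longrightarrow> x \<notin> set q \<Longrightarrow> path_in r V (q @ [x])"
  by (auto simp: path_in_def successively_append_iff)

lemma successively_flip: "symp r \<Longrightarrow> successively (\<lambda>x y. r y x) xs \<longleftrightarrow> successively r xs"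
  by (intro iffI; erule successively_mono; blast dest: sympD)

lemma path_in_rev: "symp r \<Longrightarrow> path_in r V q \<Longrightarrow> path_in r V (rev q)"
  by (simp add: path_in_def successively_flip)

lemma longest_path_rev: "symp r \<Longrightarrow> longest_path r V q \<Longrightarrow> longest_path r V (rev q)"
  by (auto simp: longest_path_def path_in_rev)

lemma finite_path_in: "finite V \<Longrightarrow> path_in r V q \<Longrightarrow> length q \<le> card V"
  by (metis path_in_def distinct_card card_mono)

lemma longest_path_exists:
  assumes "finite V" "path_in r V q0"
  obtains q where "longest_path r V q" "length q \<ge> length q0"
proof -
  let ?Q = "{length q | q. path_in r V q}"
  have fin: "finite ?Q" by (rule finite_subset[of _ "{..card V}"]) (auto simp: finite_path_in assms)
  have "Max ?Q \<in> ?Q" using fin assms(2) by (intro Max_in) auto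
  then obtain q where q: "path_in r V q" "length q = Max ?Q" by auto
  have "longest_path r V q" unfolding longest_path_def q(2)
    using q(1) fin by (auto intro!: Max_ge)
  then show thesis using that assms(2) by (auto simp: longest_path_def)
qed

text \<open>
  If the last vertex of a path is adjacent to an inner vertex \<open>x\<close>, reversing the part after \<open>x\<close>
  gives a path on the same vertices with the same first vertex; its new last vertex is the former
  successor of \<open>x\<close>.
\<close>
inductive rotated :: "('a \<Rightarrow> 'a \<Rightarrow> bool) \<Rightarrow> 'a list \<Rightarrow> 'a list \<Rightarrow> bool" for r p where
  start: "rotated r p p"
| turn: "rotated r p (a @ x # b) \<Longrightarrow> b \<noteq> [] \<Longrightarrow> r (last b) x \<Longrightarrow> rotated r p (a @ x # rev b)"

lemma rotated_path:
  assumes "symp r" "rotated r p q" "path_in r V p"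
  shows "path_in r V q \<and> set q = set p \<and> hd q = hd p"
  using assms(2)
proof induction
  case start
  then show ?case using assms(3) by simp
next
  case (turn a x b)
  have "successively r (rev b)" using turn
    by (simp add: path_in_def successively_append_iff successively_Cons successively_flip[OF assms(1)])
  moreover have "r x (last b)" using turn(3) assms(1) by (rule sympD[rotated])
  moreover have "set p \<subseteq> V" using assms(3) by (simp add: path_in_def)
  ultimately show ?case using turn
    by (simp add: path_in_def successively_append_iff successively_Cons hd_rev hd_append split: if_splits)
qed

lemma rotated_longest:
  assumes "symp r" "rotated r p q" "longest_path r V p"
  shows "longest_path r V q"
proof -
  have pp: "path_in r V p" using assms(3) by (simp add: longest_path_def)
  have "path_in r V q" "set q = set p" using rotated_path[OF assms(1,2) pp] by auto
  moreover from this pp have "length q = length p" by (metis path_in_def distinct_card)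
  ultimately show ?thesis using assms(3) by (simp add: longest_path_def)
qed

text \<open>
  A rotation breaks a single link, and one end of that link becomes the last vertex of the path. So
  a link none of whose ends is ever a last vertex is never broken.
\<close>
lemma consec_survives:
  assumes "consec p y z" "rotated r p q"
    and "\<And>q. rotated r p q \<Longrightarrow> last q \<noteq> y \<and> last q \<noteq> z"
  shows "consec q y z \<or> consec q z y"
  using assms(2)
proof induction
  case start
  then show ?case using assms(1) by simp
next
  case (turn a x b)
  have "rotated r p (a @ x # rev b)" by (rule rotated.turn) (use turn in auto)
  then have "hd b \<noteq> y" "hd b \<noteq> z" using assms(3) turn(2) by (force simp: last_rev)+
  then show ?case using turn by (auto simp: consec_append consec_rev hd_rev)
qed

text \<open>
  \<open>R\<close> is the set of last vertices of all rotations of \<open>p\<close>. A neighbour \<open>y \<notin> R\<close> of \<open>R\<close> is next to an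
  element of \<open>R\<close> on \<open>p\<close> itself: otherwise the links of \<open>p\<close> at \<open>y\<close> survive in every rotation, so the
  rotation at \<open>y\<close> would have to break one of them and thereby put a \<open>p\<close>-neighbour of \<open>y\<close> into \<open>R\<close>.
  Each element of \<open>R\<close> accounts for at most two neighbours, and \<open>last p\<close> for at most one.
\<close>
lemma posa_rotation:
  assumes sym: "symp r" and long: "longest_path r V p"
  obtains R where "last p \<in> R" "R \<subseteq> set p" "card (nbhd r V R) < 2 * card R"
    "\<And>v. v \<in> R \<Longrightarrow> \<exists>q. longest_path r V q \<and> hd q = hd p \<and> last q = v"
proof -
  define R where "R = {last q | q. rotated r p q}"
  have pp: "path_in r V p" and dp: "distinct p" using long by (auto simp: longest_path_def path_in_def)
  have lastR: "last p \<in> R" unfolding R_def using rotated.start by blast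
  have Rp: "R \<subseteq> set p"
    using rotated_path[OF sym _ pp] by (fastforce simp: R_def path_in_def)
  have finR: "finite R" using Rp finite_subset by blast
  have adjacent: "\<exists>v\<in>R. consec p v y \<or> consec p y v" if y: "y \<in> nbhd r V R" for y
  proof (rule ccontr)
    assume none: "\<not> ?thesis"
    from y obtain q where q: "rotated r p q" "r (last q) y" and yR: "y \<notin> R" "y \<in> V"
      by (auto simp: nbhd_def R_def)
    have lq: "longest_path r V q" by (rule rotated_longest[OF sym q(1) long])
    have pq: "path_in r V q" "set q = set p" "hd q = hd p" using rotated_path[OF sym q(1) pp] by auto
    have dq: "distinct q" using pq(1) by (simp add: path_in_def)
    have yq: "y \<in> set q"
    proof (rule ccontr)
      assume "y \<notin> set q"
      from path_in_snoc[OF pq(1) q(2) yR(2) this] lq have "length (q @ [y]) \<le> length q"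
        unfolding longest_path_def by blast
      then show False by simp
    qed
    then obtain a b where ab: "q = a @ y # b" by (auto simp: in_set_conv_decomp)
    have bne: "b \<noteq> []" using yR(1) q(1) ab by (auto simp: R_def)
    define z where "z = hd b"
    \<comment> \<open>Three links of \<open>q\<close> meet \<open>y\<close>: to \<open>z\<close>, which lies in \<open>R\<close>, and to \<open>y1\<close> and \<open>y2\<close>, which do not.\<close>
    have yz: "consec q y z" unfolding ab z_def using bne by (simp add: consec_append)
    have "rotated r p (a @ y # rev b)" using q bne unfolding ab by (intro rotated.turn) auto
    then have "last (a @ y # rev b) \<in> R" unfolding R_def by blast
    then have zR: "z \<in> R" using bne by (simp add: z_def last_rev)
    have keep: "consec q s t \<or> consec q t s" if "consec p s t" "s \<notin> R" "t \<notin> R" for s t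
      by (rule consec_survives[OF that(1) q(1)]) (use that in \<open>auto simp: R_def\<close>)
    have "y \<noteq> last p" using yR lastR by auto
    then obtain y1 where y1: "consec p y y1" using ex_next yq pq(2) by metis
    have y1R: "y1 \<notin> R" using none y1 by auto
    have "consec q y1 y" using keep[OF y1 yR(1) y1R] consec_unique_next[OF dq yz] zR y1R by auto
    then have "y \<noteq> hd q" using consec_not_last[of "rev q" y y1] dq by (auto simp: consec_rev last_rev)
    then obtain y2 where y2: "consec p y2 y" using ex_prev yq pq(2,3) by metis
    have y2R: "y2 \<notin> R" using none y2 by auto
    have "consec q y2 y" using keep[OF y2 y2R yR(1)] consec_unique_next[OF dq yz] zR y2R by auto
    then have "y1 = y2" using consec_unique_prev[OF dq] \<open>consec q y1 y\<close> by blast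
    then show False using y1 y2 dp
    proof -
      assume "y1 = y2"
      then have c: "consec p y y1" "consec p y1 y" using y1 y2 by auto
      have "\<not> (consec xs s t \<and> consec xs t s)" if "distinct xs" for xs and s t :: 'a
        using that by (induction xs) (auto dest: consec_in_set)
      then show False using c dp by blast
    qed
  qed
  let ?nx = "\<lambda>v. SOME y. consec p v y" and ?pv = "\<lambda>v. SOME y. consec p y v"
  have "nbhd r V R \<subseteq> ?nx ` (R - {last p}) \<union> ?pv ` R"
  proof
    fix y assume "y \<in> nbhd r V R"
    from adjacent[OF this] obtain v where v: "v \<in> R" "consec p v y \<or> consec p y v" by blast
    from v(2) show "y \<in> ?nx ` (R - {last p}) \<union> ?pv ` R"
    proof
      assume c: "consec p v y"
      then have "?nx v = y" using consec_unique_next[OF dp] someI[of "consec p v"] by blast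
      moreover have "v \<noteq> last p" using consec_not_last[OF dp c] .
      ultimately show ?thesis using v(1) by blast
    next
      assume c: "consec p y v"
      then have "?pv v = y" using consec_unique_prev[OF dp] someI[of "\<lambda>y. consec p y v"] by blast
      then show ?thesis using v(1) by blast
    qed
  qed
  then have "card (nbhd r V R) \<le> card (?nx ` (R - {last p}) \<union> ?pv ` R)"
    using finR by (intro card_mono) auto
  also have "\<dots> \<le> card (R - {last p}) + card R"
    using finR by (intro order_trans[OF card_Un_le] add_mono card_image_le) auto
  also have "\<dots> < 2 * card R"
  proof -
    have "card R > 0" using lastR finR by (auto simp: card_gt_0_iff)
    then show ?thesis using lastR finR by (simp add: card_Diff_singleton)
  qed
  finally have "card (nbhd r V R) < 2 * card R" .
  moreover have "\<exists>q. longest_path r V q \<and> hd q = hd p \<and> last q = v" if "v \<in> R" for v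
    using that rotated_longest[OF sym _ long] rotated_path[OF sym _ pp] unfolding R_def by blast
  ultimately show thesis using that lastR Rp by blast
qed

lemma far_ends_subset: "far_ends r V \<subseteq> V \<times> V"
  using hd_in_set last_in_set by (force simp: far_ends_def longest_path_def path_in_def)

text \<open>
  Rotating with the first end fixed gives more than \<open>k\<close> second ends; reversing each of these paths
  and rotating again gives more than \<open>k\<close> partners for each of them.
\<close>
lemma card_far_ends:
  assumes fin: "finite V" and sym: "symp r"
    and expand: "\<And>S. S \<subseteq> V \<Longrightarrow> card S \<le> k \<Longrightarrow> card (nbhd r V S) \<ge> 2 * card S"
    and edge: "\<exists>q. path_in r V q \<and> length q \<ge> 2"
  shows "card (far_ends r V) \<ge> k ^ 2"
proof -
  obtain p where p: "longest_path r V p" "length p \<ge> 2"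
    using edge longest_path_exists[OF fin] by (metis le_trans)
  have len: "length q \<ge> 2" if "longest_path r V q" for q
    using that p by (meson longest_path_def order_trans)
  have many: "\<exists>R. R \<subseteq> V \<and> card R \<ge> k \<and> (\<forall>v\<in>R. (hd q, v) \<in> far_ends r V \<and> (v, hd q) \<in> far_ends r V)"
    if q: "longest_path r V q" for q
  proof -
    obtain R where R: "last q \<in> R" "R \<subseteq> set q" "card (nbhd r V R) < 2 * card R"
      "\<And>v. v \<in> R \<Longrightarrow> \<exists>q'. longest_path r V q' \<and> hd q' = hd q \<and> last q' = v"
      using posa_rotation[OF sym q] by blast
    have RV: "R \<subseteq> V" using R(2) q by (auto simp: longest_path_def path_in_def)
    have "\<not> card R \<le> k" using expand[OF RV] R(3) by linarith
    moreover have "(hd q, v) \<in> far_ends r V \<and> (v, hd q) \<in> far_ends r V" if v: "v \<in> R" for v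
    proof -
      from R(4)[OF v] obtain q' where q': "longest_path r V q'" "hd q' = hd q" "last q' = v" by blast
      have "distinct q'" "q' \<noteq> []" using q'(1) by (auto simp: longest_path_def path_in_def)
      then have "hd q' \<noteq> last q'" using len[OF q'(1)]
        by (cases q') (auto split: if_splits)
      then show ?thesis using q' longest_path_rev[OF sym q'(1)] \<open>q' \<noteq> []\<close>
        unfolding far_ends_def by (force simp: hd_rev last_rev)
    qed
    ultimately show ?thesis using RV by (intro exI[of _ R]) auto
  qed
  obtain R where R: "R \<subseteq> V" "card R \<ge> k" "\<forall>v\<in>R. (hd p, v) \<in> far_ends r V \<and> (v, hd p) \<in> far_ends r V"
    using many[OF p(1)] by blast
  define S where "S v = {w. (v, w) \<in> far_ends r V}" for v
  have finfar: "finite (far_ends r V)"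
    by (rule finite_subset[OF far_ends_subset]) (simp add: fin)
  have SV: "S v \<subseteq> V" for v using far_ends_subset[of r V] by (auto simp: S_def)
  have S: "card (S v) \<ge> k" if v: "v \<in> R" for v
  proof -
    from R(3) v obtain q where q: "longest_path r V q" "hd q = v" unfolding far_ends_def by blast
    from many[OF q(1)] obtain T where T: "card T \<ge> k" "\<forall>w\<in>T. (v, w) \<in> far_ends r V"
      unfolding q(2) by metis
    then have "card T \<le> card (S v)" using finite_subset[OF SV fin]
      by (intro card_mono) (auto simp: S_def)
    then show ?thesis using T(1) by simp
  qed
  have "k ^ 2 \<le> card R * k" using R(2) by (simp add: power2_eq_square)
  also have "\<dots> = (\<Sum>v\<in>R. k)" by simp
  also have "\<dots> \<le> (\<Sum>v\<in>R. card (S v))" using S by (intro sum_mono) auto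
  also have "\<dots> = card (Sigma R S)"
    using R(1) SV fin by (subst card_SigmaI) (auto intro: finite_subset)
  also have "\<dots> \<le> card (far_ends r V)"
    using finfar by (intro card_mono) (auto simp: S_def)
  finally show ?thesis .
qed

lemma closing_longest_path:
  assumes sym: "symp r" and q: "longest_path r V q"
    and closed: "r (last q) (hd q)"
    and connected: "\<And>C. C \<subset> V \<Longrightarrow> C \<noteq> {} \<Longrightarrow> nbhd r V C \<noteq> {}"
  shows "set q = V"
proof (rule ccontr)
  assume "set q \<noteq> V"
  moreover have pq: "path_in r V q" using q by (simp add: longest_path_def)
  ultimately have "nbhd r V (set q) \<noteq> {}" by (intro connected) (auto simp: path_in_def)
  then obtain x y where xy: "x \<in> V" "x \<notin> set q" "y \<in> set q" "r y x" by (auto simp: nbhd_def)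
  then obtain a b where ab: "q = a @ y # b" by (auto simp: in_set_conv_decomp)
  have "path_in r V (x # y # b @ a)"
  proof -
    have "r x y" using xy sym by (auto dest: sympD)
    moreover have "successively r (y # b @ a)"
    proof (cases "a = []")
      case True
      then show ?thesis using pq ab by (simp add: path_in_def)
    next
      case False
      then show ?thesis using pq closed ab
        by (auto simp: path_in_def successively_append_iff successively_Cons split: if_splits)
    qed
    ultimately show ?thesis using pq xy ab by (auto simp: path_in_def)
  qed
  then have "length (x # y # b @ a) \<le> length q" using q unfolding longest_path_def by blast
  then show False using ab by simp
qed

section \<open>Shadow graphs and weak cycles\<close>

definition shadow :: "'a set set \<Rightarrow> 'a \<Rightarrow> 'a \<Rightarrow> bool" where
  "shadow E u v \<longleftrightarrow> u \<noteq> v \<and> (\<exists>e\<in>E. u \<in> e \<and> v \<in> e)"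

lemma symp_shadow: "symp (shadow E)"
  by (auto simp: symp_def shadow_def)

lemma shadow_mono: "F \<subseteq> E \<Longrightarrow> shadow F u v \<Longrightarrow> shadow E u v"
  by (auto simp: shadow_def)

lemma weak_cycle_of_path:
  assumes path: "path_in (shadow E) V q" and len: "length q \<ge> 3" and V: "V \<subseteq> A"
    and closed: "shadow E (last q) (hd q)"
  shows "\<exists>v e. weak_cycle (A, E) (length q) v e \<and> spanned_vertices (length q) v = set q"
proof -
  define l where "l = length q"
  define v where "v i = q ! (i mod l)" for i
  have l: "l \<ge> 3" using len by (simp add: l_def)
  have q: "q \<noteq> []" "distinct q" "set q \<subseteq> V" "successively (shadow E) q"
    using path by (auto simp: path_in_def)
  have ih: "shadow E (xs ! i) (xs ! Suc i)" if "successively (shadow E) xs" "Suc i < length xs" for xs i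
    using that
  proof (induction xs arbitrary: i)
    case (Cons x xs)
    then show ?case by (cases i) (auto simp: successively_Cons hd_conv_nth split: if_splits)
  qed simp
  have sh: "shadow E (v (i - 1)) (v i)" if "i \<in> {1..l}" for i
  proof (cases "i = l")
    case True
    then show ?thesis using closed l q(1)
      by (simp add: v_def l_def last_conv_nth hd_conv_nth)
  next
    case False
    then have "Suc (i - 1) < length q" "i = Suc (i - 1)" "i < l" using that by (auto simp: l_def)
    then show ?thesis using ih[OF q(4), of "i - 1"] by (simp add: v_def)
  qed
  then have "\<forall>i\<in>{1..l}. \<exists>e. e \<in> E \<and> v (i - 1) \<in> e \<and> v i \<in> e"
    unfolding shadow_def by blast
  then obtain e where e: "\<forall>i\<in>{1..l}. e i \<in> E \<and> v (i - 1) \<in> e i \<and> v i \<in> e i"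
    by metis
  have inj: "inj_on v {..<l}" using q(2) by (auto simp: inj_on_def v_def l_def nth_eq_iff_index_eq)
  have im: "v ` {..<l} = set q" by (auto simp: v_def l_def set_conv_nth)
  have "weak_cycle (A, E) l v e"
    unfolding weak_cycle_def using l inj im q(3) V e by (auto simp: verts_def hedges_def v_def)
  then show ?thesis using im unfolding l_def spanned_vertices_def by blast
qed

section \<open>Expansion of sparse subhypergraphs\<close>

definition edge_deg :: "'a set set \<Rightarrow> 'a \<Rightarrow> nat" where
  "edge_deg E v = card {e \<in> E. v \<in> e}"

text \<open>
  A walk in the hypergraph that ends at the vertex \<open>u\<close>: consecutive edges intersect and the last one
  contains \<open>u\<close>. Repetitions are harmless, so the length can be fixed.
\<close>
fun chain :: "'a \<Rightarrow> 'a set list \<Rightarrow> bool" where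
  "chain u [] \<longleftrightarrow> False"
| "chain u [e] \<longleftrightarrow> u \<in> e"
| "chain u (f # e # es) \<longleftrightarrow> f \<inter> e \<noteq> {} \<and> chain u (e # es)"

definition locally_sparse :: "nat \<Rightarrow> 'a set set \<Rightarrow> bool" where
  "locally_sparse t E \<longleftrightarrow>
     (\<forall>T. finite T \<longrightarrow> T \<noteq> {} \<longrightarrow> card T \<le> t \<longrightarrow> card {e \<in> E. e \<subseteq> T} < 3 * card T)"

text \<open>
  Length 4 is what \<open>small_set_expansion\<close> needs: an edge at each of the two low-degree vertices, and
  two intersecting edges in between.
\<close>
definition low_degrees_apart :: "nat \<Rightarrow> 'a set set \<Rightarrow> bool" where
  "low_degrees_apart K E \<longleftrightarrow>
     (\<forall>u w es. chain u es \<longrightarrow> set es \<subseteq> E \<longrightarrow> length es = 4 \<longrightarrow> w \<in> hd es \<longrightarrow>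
        edge_deg E u < K \<longrightarrow> edge_deg E w < K \<longrightarrow> u = w)"

definition joins_large_sets :: "'a set \<Rightarrow> nat \<Rightarrow> 'a set set \<Rightarrow> bool" where
  "joins_large_sets V s E \<longleftrightarrow>
     (\<forall>A B. A \<subseteq> V \<longrightarrow> B \<subseteq> V \<longrightarrow> A \<inter> B = {} \<longrightarrow> s \<le> card A \<longrightarrow> card V \<le> 4 * card B \<longrightarrow>
        (\<exists>e\<in>E. e \<inter> A \<noteq> {} \<and> e \<inter> B \<noteq> {}))"

abbreviation neighbours :: "'a set set \<Rightarrow> 'a set \<Rightarrow> 'a set" where
  "neighbours E S \<equiv> nbhd (shadow E) (\<Union>E) S"

lemma mem_neighbours: "y \<in> neighbours E S \<longleftrightarrow> y \<notin> S \<and> (\<exists>x\<in>S. \<exists>e\<in>E. x \<in> e \<and> y \<in> e)"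
  by (auto simp: nbhd_def shadow_def)

lemma locally_sparse_subset:
  fixes E F :: "'a set set"
  assumes "finite E" "F \<subseteq> E" "locally_sparse t E"
  shows "locally_sparse t F"
  unfolding locally_sparse_def
proof (intro allI impI)
  fix T :: "'a set" assume T: "finite T" "T \<noteq> {}" "card T \<le> t"
  have "card {e \<in> F. e \<subseteq> T} \<le> card {e \<in> E. e \<subseteq> T}"
    using assms by (intro card_mono) auto
  then show "card {e \<in> F. e \<subseteq> T} < 3 * card T"
    using assms(3) T unfolding locally_sparse_def by fastforce
qed

text \<open>
  If \<open>S\<close> had fewer than \<open>6 |S|\<close> neighbours, all edges at \<open>S\<close> would lie inside a set of fewer than
  \<open>7 |S|\<close> vertices. Double counting finds at least \<open>21 |S|\<close> of them, which is 3 for each vertex of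
  this set: that is where the degree bound \<open>21 d\<close> comes from.
\<close>
lemma high_degree_expansion:
  assumes fin: "finite F" and d: "d > 0" and unif: "\<And>e. e \<in> F \<Longrightarrow> finite e \<and> card e = d"
    and deg: "\<And>v. v \<in> S \<Longrightarrow> 21 * d \<le> edge_deg F v"
    and S: "finite S" "7 * card S \<le> t" and sparse: "locally_sparse t F"
  shows "6 * card S \<le> card (neighbours F S)"
proof (cases "S = {}")
  case False
  define T where "T = S \<union> neighbours F S"
  have fN: "finite (neighbours F S)"
    by (rule finite_subset[of _ "\<Union>F"]) (auto simp: nbhd_def fin unif)
  show ?thesis
  proof (rule ccontr)
    assume "\<not> ?thesis"
    then have cT: "card T < 7 * card S"
      using card_Un_le[of S "neighbours F S"] by (simp add: T_def)
    let ?M = "{e \<in> F. e \<inter> S \<noteq> {}}"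
    have "21 * d * card S = (\<Sum>v\<in>S. 21 * d)" by simp
    also have "\<dots> \<le> (\<Sum>v\<in>S. edge_deg F v)" by (intro sum_mono deg)
    also have "\<dots> = (\<Sum>v\<in>S. \<Sum>e\<in>F. if v \<in> e then 1 else 0)"
      using fin by (simp add: edge_deg_def sum.inter_filter[symmetric])
    also have "\<dots> = (\<Sum>e\<in>F. card (e \<inter> S))"
      using S by (subst sum.swap) (simp add: sum.inter_filter[symmetric] Int_def conj_commute)
    also have "\<dots> = (\<Sum>e\<in>?M. card (e \<inter> S))"
      using fin by (intro sum.mono_neutral_right) auto
    also have "\<dots> \<le> (\<Sum>e\<in>?M. d)"
      using unif by (intro sum_mono) (auto, metis card_mono inf_le1)
    also have "\<dots> = d * card ?M" by simp
    finally have "21 * card S \<le> card ?M" using d by (simp add: mult.assoc mult.left_commute)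
    also have "card ?M \<le> card {e \<in> F. e \<subseteq> T}"
      using fin by (intro card_mono) (auto simp: T_def mem_neighbours)
    also have "\<dots> < 3 * card T"
      using sparse S fN False cT unfolding locally_sparse_def T_def by auto
    finally show False using cT by linarith
  qed
qed simp

text \<open>
  Split \<open>S\<close> into the vertices \<open>S1\<close> of low degree and the rest \<open>S2\<close>. Each \<open>u \<in> S1\<close> gets a cluster \<open>C u\<close>
  consisting of \<open>u\<close> and two further vertices of one edge at \<open>u\<close>. The clusters are disjoint and no
  vertex has neighbours in two of them, since low-degree vertices are far apart. So the clusters
  contribute at least \<open>2 |S1| - |S2|\<close> neighbours, and they contain at most \<open>3 |S2|\<close> of the
  \<open>6 |S2|\<close> neighbours of \<open>S2\<close>; in total \<open>2 |S1| + 2 |S2|\<close> remain. Using only two neighbours of each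
  low-degree vertex, instead of all of them, keeps this loss bounded.
\<close>
lemma small_set_expansion:
  assumes fin: "finite H" and d: "d \<ge> 3" and unif: "\<And>e. e \<in> H \<Longrightarrow> finite e \<and> card e = d"
    and FH: "F \<subseteq> H" "\<Union>F = \<Union>H" and deg: "\<And>v. min (21 * d) (edge_deg H v) \<le> edge_deg F v"
    and sparse: "locally_sparse t H" and apart: "low_degrees_apart (21 * d) H"
    and S: "S \<subseteq> \<Union>H" "7 * card S \<le> t"
  shows "2 * card S \<le> card (neighbours F S)"
proof -
  have finF: "finite F" using fin FH(1) finite_subset by blast
  have finV: "finite (\<Union>H)" using fin unif by auto
  have finS: "finite S" using S(1) finV finite_subset by blast
  have finN: "finite (neighbours F X)" for X
    by (rule finite_subset[of _ "\<Union>H"]) (use FH finV in \<open>auto simp: nbhd_def\<close>)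
  define S1 where "S1 = {v \<in> S. edge_deg H v < 21 * d}"
  define S2 where "S2 = S - S1"
  have fin12: "finite S1" "finite S2" "S1 \<union> S2 = S" "S1 \<inter> S2 = {}"
    using finS by (auto simp: S1_def S2_def)
  have cS: "card S = card S1 + card S2" using card_Un_disjoint fin12 by metis
  have "\<exists>C. u \<in> C \<and> card C = 3 \<and> (\<exists>e\<in>F. C \<subseteq> e)" if u: "u \<in> S1" for u
  proof -
    have "u \<in> \<Union>F" using u S(1) FH(2) by (auto simp: S1_def)
    then obtain e where e: "e \<in> F" "u \<in> e" by blast
    have "finite e" "card e = d" using unif e FH(1) by blast+
    then have "2 \<le> card (e - {u})" using e(2) d by simp
    then obtain D where D: "D \<subseteq> e - {u}" "card D = 2" "finite D"
      by (rule obtain_subset_with_card_n)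
    have "card (insert u D) = 3" using D by (subst card_insert_disjoint) auto
    then show ?thesis using D e by (intro exI[of _ "insert u D"]) auto
  qed
  then have "\<forall>u\<in>S1. \<exists>C. u \<in> C \<and> card C = 3 \<and> (\<exists>e\<in>F. C \<subseteq> e)" by blast
  from bchoice[OF this] obtain C where
    C: "\<And>u. u \<in> S1 \<Longrightarrow> u \<in> C u \<and> card (C u) = 3 \<and> (\<exists>e\<in>F. C u \<subseteq> e)" by blast
  have finC: "finite (C u)" if "u \<in> S1" for u using C[OF that] card.infinite by fastforce
  have same: "u = w" if u: "u \<in> S1" and w: "w \<in> S1" and f: "f \<in> F" "f \<inter> C u \<noteq> {}"
    and g: "g \<in> F" "g \<inter> C w \<noteq> {}" "f \<inter> g \<noteq> {}" for u w f g
  proof -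
    obtain e where e: "e \<in> F" "C u \<subseteq> e" using C[OF u] by blast
    obtain e' where e': "e' \<in> F" "C w \<subseteq> e'" using C[OF w] by blast
    have "chain u [e', g, f, e]" using e e' f g C[OF u] by auto
    moreover have "w \<in> hd [e', g, f, e]" using e' C[OF w] by auto
    moreover have "set [e', g, f, e] \<subseteq> H" using e e' f g FH(1) by auto
    moreover have "edge_deg H u < 21 * d" "edge_deg H w < 21 * d" using u w by (auto simp: S1_def)
    ultimately show ?thesis using apart unfolding low_degrees_apart_def by fastforce
  qed
  define Z where "Z = (\<Union>u\<in>S1. C u)"
  have finZ: "finite Z" using fin12 finC by (auto simp: Z_def)
  have S1Z: "S1 \<subseteq> Z" using C by (auto simp: Z_def)
  \<comment> \<open>For clusters that overlap, an edge containing one of them links them.\<close>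
  have disj: "C u \<inter> C w = {}" if uw: "u \<in> S1" "w \<in> S1" "u \<noteq> w" for u w
  proof (rule ccontr)
    assume ne: "C u \<inter> C w \<noteq> {}"
    obtain e where e: "e \<in> F" "C u \<subseteq> e" using C[OF uw(1)] by blast
    have "u = w" using same[OF uw(1,2) e(1) _ e(1)] e ne by blast
    then show False using uw(3) by simp
  qed
  have cZ: "card Z = 3 * card S1" unfolding Z_def
    using fin12 finC disj C by (subst card_UN_disjoint) auto
  have one: "card (neighbours F {v} \<inter> Z) \<le> 3" for v
  proof (cases "neighbours F {v} \<inter> Z = {}")
    case False
    then obtain z u where z: "z \<in> neighbours F {v}" "u \<in> S1" "z \<in> C u" by (auto simp: Z_def)
    then obtain f where f: "f \<in> F" "v \<in> f" "z \<in> f" by (auto simp: mem_neighbours)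
    have "neighbours F {v} \<inter> Z \<subseteq> C u"
    proof
      fix y assume "y \<in> neighbours F {v} \<inter> Z"
      then obtain w g where w: "w \<in> S1" "y \<in> C w" "g \<in> F" "v \<in> g" "y \<in> g"
        by (auto simp: Z_def mem_neighbours)
      have "u = w" by (rule same[OF z(2) w(1) f(1) _ w(3)]) (use w z f in auto)
      then show "y \<in> C u" using w by simp
    qed
    then show ?thesis using card_mono[OF finC[OF z(2)]] C[OF z(2)] by metis
  qed simp
  have "neighbours F S2 \<inter> Z \<subseteq> (\<Union>v\<in>S2. neighbours F {v} \<inter> Z)"
  proof
    fix y assume y: "y \<in> neighbours F S2 \<inter> Z"
    then obtain v e where v: "y \<notin> S2" "v \<in> S2" "e \<in> F" "v \<in> e" "y \<in> e"
      by (auto simp: mem_neighbours)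
    then have "y \<in> neighbours F {v}" by (auto simp: mem_neighbours)
    then show "y \<in> (\<Union>v\<in>S2. neighbours F {v} \<inter> Z)" using y v(2) by blast
  qed
  then have "card (neighbours F S2 \<inter> Z) \<le> card (\<Union>v\<in>S2. neighbours F {v} \<inter> Z)"
    using fin12 finZ by (intro card_mono) auto
  also have "\<dots> \<le> (\<Sum>v\<in>S2. card (neighbours F {v} \<inter> Z))" using fin12(2) by (rule card_UN_le)
  also have "\<dots> \<le> (\<Sum>v\<in>S2. 3)" by (intro sum_mono one)
  finally have NZ: "card (neighbours F S2 \<inter> Z) \<le> 3 * card S2" by simp
  have N2: "6 * card S2 \<le> card (neighbours F S2)"
  proof (rule high_degree_expansion[OF finF, of d])
    show "21 * d \<le> edge_deg F v" if "v \<in> S2" for v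
      using deg[of v] that by (auto simp: S1_def S2_def)
    show "7 * card S2 \<le> t" using S(2) cS by simp
    show "locally_sparse t F" by (rule locally_sparse_subset[OF fin FH(1) sparse])
  qed (use d unif FH fin12 in auto)
  have cZS: "card (Z - S) + card S \<ge> card Z"
  proof -
    have "card Z \<le> card ((Z - S) \<union> S)" using finZ finS by (intro card_mono) auto
    then show ?thesis using card_Un_le[of "Z - S" S] by linarith
  qed
  have cN2Z: "card (neighbours F S2 - Z) + card (neighbours F S2 \<inter> Z) = card (neighbours F S2)"
    using card_Int_Diff[OF finN, of S2 Z] by linarith
  have "(Z - S) \<union> (neighbours F S2 - Z) \<subseteq> neighbours F S"
  proof
    fix z assume "z \<in> (Z - S) \<union> (neighbours F S2 - Z)"
    then show "z \<in> neighbours F S"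
    proof
      assume z: "z \<in> Z - S"
      then obtain u where u: "u \<in> S1" "z \<in> C u" by (auto simp: Z_def)
      then obtain e where "e \<in> F" "C u \<subseteq> e" using C by blast
      moreover have "u \<in> S" "u \<in> C u" using u C by (auto simp: S1_def)
      ultimately show ?thesis using z u by (auto simp: mem_neighbours)
    next
      assume "z \<in> neighbours F S2 - Z"
      then show ?thesis using S1Z fin12(3) by (fastforce simp: mem_neighbours)
    qed
  qed
  then have "card ((Z - S) \<union> (neighbours F S2 - Z)) \<le> card (neighbours F S)"
    using finN by (intro card_mono) auto
  moreover have "card ((Z - S) \<union> (neighbours F S2 - Z)) = card (Z - S) + card (neighbours F S2 - Z)"
    using finN finZ by (intro card_Un_disjoint) auto
  ultimately show ?thesis using NZ N2 cZS cN2Z cZ cS by linarith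
qed

text \<open>
  Sets of fewer than \<open>s\<close> vertices expand by \<open>small_set_expansion\<close>. If \<open>s \<le> |S| \<le> |V| / 4\<close> and \<open>S\<close>
  had fewer than \<open>2 |S|\<close> neighbours, more than a quarter of \<open>V\<close> would be left over, and some edge
  would join it to \<open>S\<close>. A set without outside neighbours and its complement both exceed
  \<open>|V| / 4\<close> by expansion, and then an edge joins the two.
\<close>
lemma expansion_and_connectivity:
  assumes fin: "finite V" and d: "d \<ge> 3" and HV: "H \<subseteq> nsets V d"
    and FH: "F \<subseteq> H" "\<Union>F = \<Union>H" and deg: "\<And>v. min (21 * d) (edge_deg H v) \<le> edge_deg F v"
    and sparse: "locally_sparse t H" and apart: "low_degrees_apart (21 * d) H"
    and joins: "joins_large_sets V s F" and s: "7 * s \<le> t + 7" "s \<le> card V div 4"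
  shows "\<And>S. S \<subseteq> \<Union>F \<Longrightarrow> card S \<le> card V div 4 \<Longrightarrow> 2 * card S \<le> card (neighbours F S)"
    and "\<And>C. C \<subset> \<Union>F \<Longrightarrow> C \<noteq> {} \<Longrightarrow> neighbours F C \<noteq> {}"
proof -
  have HPow: "H \<subseteq> Pow V" using HV by (auto simp: nsets_def)
  have finH: "finite H" using HPow fin by (meson finite_Pow_iff finite_subset)
  have FV: "\<Union>F \<subseteq> V" using HPow FH by blast
  show expand: "2 * card S \<le> card (neighbours F S)" if S: "S \<subseteq> \<Union>F" "card S \<le> card V div 4" for S
  proof (cases "card S < s")
    case True
    show ?thesis
      by (rule small_set_expansion[OF finH d _ FH deg sparse apart])
        (use HV S FH True s in \<open>auto simp: nsets_def\<close>)
  next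
    case False
    show ?thesis
    proof (rule ccontr)
      assume less: "\<not> ?thesis"
      define B where "B = V - (S \<union> neighbours F S)"
      have "card (S \<union> neighbours F S) \<le> 3 * card S"
        using card_Un_le[of S "neighbours F S"] less by linarith
      moreover have "card V - card (S \<union> neighbours F S) \<le> card B"
        unfolding B_def by (rule diff_card_le_card_Diff)
          (rule finite_subset[OF _ fin], use S FV in \<open>auto simp: nbhd_def\<close>)
      ultimately have "card V \<le> 4 * card B" using S(2) by linarith
      moreover have "S \<subseteq> V" "B \<subseteq> V" "S \<inter> B = {}" "s \<le> card S"
        using S FV False by (auto simp: B_def)
      ultimately obtain e where e: "e \<in> F" "e \<inter> S \<noteq> {}" "e \<inter> B \<noteq> {}"
        using joins[unfolded joins_large_sets_def, rule_format, of S B] by blast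
      then obtain x y where "x \<in> e" "x \<in> S" "y \<in> e" "y \<in> B" by blast
      moreover from this have "y \<notin> S" "y \<notin> neighbours F S" by (simp_all add: B_def)
      ultimately show False using e(1) unfolding mem_neighbours by blast
    qed
  qed
  have big: "card V \<le> 4 * card C" "s \<le> card C" if "C \<subseteq> \<Union>F" "C \<noteq> {}" "neighbours F C = {}" for C
  proof -
    have "card C > 0" using that FV fin by (meson card_gt_0_iff finite_subset)
    then have "\<not> card C \<le> card V div 4" using expand[OF that(1)] that(3) by fastforce
    then show "card V \<le> 4 * card C" "s \<le> card C" using s(2) by linarith+
  qed
  show "neighbours F C \<noteq> {}" if C: "C \<subset> \<Union>F" "C \<noteq> {}" for C
  proof
    assume closed: "neighbours F C = {}"
    define D where "D = \<Union>F - C"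
    have D: "neighbours F D = {}"
    proof -
      have False if y: "y \<in> neighbours F D" for y
      proof -
        from y obtain x e where xe: "y \<notin> D" "x \<in> D" "e \<in> F" "x \<in> e" "y \<in> e"
          by (auto simp: mem_neighbours)
        then have "x \<in> neighbours F C" unfolding mem_neighbours by (auto simp: D_def)
        then show False using closed by simp
      qed
      then show ?thesis by blast
    qed
    have "card V \<le> 4 * card D" using big(1)[of D] C D by (auto simp: D_def)
    moreover have "s \<le> card C" using big(2)[of C] C closed by auto
    moreover have "C \<subseteq> V" "D \<subseteq> V" "C \<inter> D = {}" using C FV by (auto simp: D_def)
    ultimately obtain e where "e \<in> F" "e \<inter> C \<noteq> {}" "e \<inter> D \<noteq> {}"
      using joins[unfolded joins_large_sets_def, rule_format, of C D] by blast
    then obtain x y where "x \<in> e" "x \<in> C" "y \<in> e" "y \<in> D" by blast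
    then have "y \<in> neighbours F C" unfolding mem_neighbours using \<open>e \<in> F\<close> by (auto simp: D_def)
    then show False using closed by simp
  qed
qed

lemma path_edges:
  assumes "successively (shadow H) q"
  obtains P where "P \<subseteq> H" "finite P" "card P \<le> length q" "successively (shadow P) q"
proof -
  have "\<exists>P\<subseteq>H. finite P \<and> card P \<le> length q \<and> successively (shadow P) q" using assms
  proof (induction q)
    case Nil
    then show ?case by (intro exI[of _ "{}"]) auto
  next
    case (Cons x q)
    then obtain P where P: "P \<subseteq> H" "finite P" "card P \<le> length q" "successively (shadow P) q"
      by (auto simp: successively_Cons)
    show ?case
    proof (cases "q = []")
      case True
      then show ?thesis by (intro exI[of _ "{}"]) auto
    next
      case False
      then obtain e where e: "e \<in> H" "x \<in> e" "hd q \<in> e" "x \<noteq> hd q"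
        using Cons.prems by (auto simp: successively_Cons shadow_def)
      have "successively (shadow (insert e P)) q" using P(4)
        by (rule successively_mono) (auto intro: shadow_mono[of P])
      then have "successively (shadow (insert e P)) (x # q)"
        using e by (auto simp: successively_Cons shadow_def)
      moreover have "card (insert e P) \<le> length (x # q)"
        using P(2,3) by (simp add: card_insert_if)
      ultimately show ?thesis using P e by (intro exI[of _ "insert e P"]) auto
    qed
  qed
  then show thesis using that by blast
qed

lemma path_in_shadow_mono:
  assumes "F \<subseteq> H" "path_in (shadow F) (\<Union>F) q"
  shows "path_in (shadow H) (\<Union>H) q"
proof -
  have "\<Union>F \<subseteq> \<Union>H" using assms(1) by blast
  then show ?thesis using assms unfolding path_in_def
    by (auto intro: successively_mono[of "shadow F" q "shadow H"] shadow_mono)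
qed

text \<open>
  \<open>F\<close> consists of the edges in \<open>Q\<close> and of a set \<open>X\<close> that contains up to \<open>21 d\<close> edges at every vertex
  and the edges of a longest path of \<open>H\<close>. Hence longest paths of \<open>F\<close> are longest paths of \<open>H\<close>, and
  an edge of \<open>H\<close> on the ends of one of them would close it to a spanning cycle.
\<close>
lemma weak_cycle_or_missing_boosters:
  assumes fin: "finite V" and d: "d \<ge> 3" and HV: "H \<subseteq> nsets V d"
    and sparse: "locally_sparse t H" and apart: "low_degrees_apart (21 * d) H"
    and joins: "joins_large_sets V s (H \<inter> Q)" and s: "7 * s \<le> t + 7" "s \<le> card V div 4"
    and V: "V \<noteq> {}"
    and none: "\<not> (\<exists>l v e. weak_cycle (V, H) l v e \<and> spanned_vertices l v = \<Union>H)"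
  obtains F1 where "F1 \<subseteq> H - Q" "card F1 \<le> (21 * d + 1) * card V"
    "(card V div 4)\<^sup>2 \<le> card (far_ends (shadow (H \<inter> Q \<union> F1)) (\<Union>(H \<inter> Q \<union> F1)))"
    "\<And>u v e. (u, v) \<in> far_ends (shadow (H \<inter> Q \<union> F1)) (\<Union>(H \<inter> Q \<union> F1)) \<Longrightarrow> e \<in> H \<Longrightarrow> \<not> (u \<in> e \<and> v \<in> e)"
proof -
  have HPow: "H \<subseteq> Pow V" using HV by (auto simp: nsets_def)
  have finH: "finite H" using HPow fin by (meson finite_Pow_iff finite_subset)
  have UHV: "\<Union>H \<subseteq> V" using HPow by blast
  then have finUH: "finite (\<Union>H)" using fin finite_subset by blast
  have unif: "finite e \<and> card e = d" if "e \<in> H" for e using that HV by (auto simp: nsets_def)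
  \<comment> \<open>Joining a quarter of the vertices to the rest shows that there is an edge at all.\<close>
  obtain A where A: "A \<subseteq> V" "card A = card V div 4" "finite A"
    by (rule obtain_subset_with_card_n[of "card V div 4" V]) auto
  have "card (V - A) = card V - card V div 4" using A by (simp add: card_Diff_subset)
  then have "card V \<le> 4 * card (V - A)" by linarith
  moreover have "A \<inter> (V - A) = {}" "V - A \<subseteq> V" "s \<le> card A" using A s by auto
  ultimately obtain e0 where e0: "e0 \<in> H \<inter> Q"
    using joins A(1) unfolding joins_large_sets_def by blast
  then have "card e0 \<ge> 2" using unif d by fastforce
  then obtain x0 y0 where xy: "x0 \<in> e0" "y0 \<in> e0" "x0 \<noteq> y0"
    by (meson card_2_iff' ex_card subsetD)
  have pair: "path_in (shadow F) (\<Union>F) [x0, y0]" if "e0 \<in> F" for F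
    using xy that by (auto simp: path_in_def shadow_def)
  have e0H: "e0 \<in> H" using e0 by simp
  obtain q where q: "longest_path (shadow H) (\<Union>H) q"
    using longest_path_exists[OF finUH pair[OF e0H]] by blast
  have pq: "path_in (shadow H) (\<Union>H) q" using q by (simp add: longest_path_def)
  then obtain P where P: "P \<subseteq> H" "finite P" "card P \<le> length q" "successively (shadow P) q"
    using path_edges by (metis path_in_def)
  have "length q \<le> card (\<Union>H)" by (rule finite_path_in[OF finUH pq])
  also have "\<dots> \<le> card V" using HPow by (intro card_mono[OF fin]) auto
  finally have cP: "card P \<le> card V" using P(3) by linarith
  have "\<exists>D. D \<subseteq> {e \<in> H. v \<in> e} \<and> card D = min (21 * d) (edge_deg H v)" for v
    by (rule obtain_subset_with_card_n[of "min (21 * d) (edge_deg H v)" "{e \<in> H. v \<in> e}"])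
      (auto simp: edge_deg_def)
  then obtain D where D: "\<And>v. D v \<subseteq> {e \<in> H. v \<in> e}" "\<And>v. card (D v) = min (21 * d) (edge_deg H v)"
    by metis
  define X where "X = P \<union> (\<Union>v\<in>V. D v)"
  have XH: "X \<subseteq> H" using P(1) D(1) by (auto simp: X_def)
  define F where "F = H \<inter> Q \<union> (X - Q)"
  have FH: "F \<subseteq> H" and XF: "X \<subseteq> F" using XH by (auto simp: F_def)
  have finF: "finite F" using FH finH finite_subset by blast
  have deg: "min (21 * d) (edge_deg H v) \<le> edge_deg F v" for v
  proof (cases "v \<in> V")
    case True
    then have "D v \<subseteq> {e \<in> F. v \<in> e}" using D(1)[of v] XF by (auto simp: X_def)
    then have "card (D v) \<le> edge_deg F v" unfolding edge_deg_def using finF by (intro card_mono) auto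
    then show ?thesis using D(2) by simp
  next
    case False
    then have none_at: "{e \<in> H. v \<in> e} = {}" using HPow by auto
    have "edge_deg H v = 0" unfolding edge_deg_def none_at by simp
    then show ?thesis by simp
  qed
  have UF: "\<Union>F = \<Union>H"
  proof
    show "\<Union>H \<subseteq> \<Union>F"
    proof
      fix v assume "v \<in> \<Union>H"
      then have "edge_deg H v > 0" using finH by (auto simp: edge_deg_def card_gt_0_iff)
      then have "edge_deg F v > 0" using deg[of v] d by linarith
      then have "{e \<in> F. v \<in> e} \<noteq> {}" unfolding edge_deg_def by (metis card.empty less_irrefl)
      then show "v \<in> \<Union>F" by blast
    qed
  qed (use FH in blast)
  have joinsF: "joins_large_sets V s F"
    using joins unfolding joins_large_sets_def F_def by (meson UnCI)
  note ec = expansion_and_connectivity[OF fin d HV FH UF deg sparse apart joinsF s]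
  have finUF: "finite (\<Union>F)" using UF finUH by simp
  have "path_in (shadow F) (\<Union>F) q"
    using pq P(4) XF UF unfolding path_in_def X_def
    by (auto intro: successively_mono[of "shadow P" q] shadow_mono[of P F])
  then have qF: "length q \<le> length q'" if "longest_path (shadow F) (\<Union>F) q'" for q'
    using that unfolding longest_path_def by blast
  have inH: "longest_path (shadow H) (\<Union>H) q'" if q': "longest_path (shadow F) (\<Union>F) q'" for q'
    unfolding longest_path_def
  proof (intro conjI allI impI)
    show "path_in (shadow H) (\<Union>H) q'"
      using path_in_shadow_mono[OF FH] q' unfolding longest_path_def by blast
    fix ys assume "path_in (shadow H) (\<Union>H) ys"
    then have "length ys \<le> length q" using q unfolding longest_path_def by blast
    also have "\<dots> \<le> length q'" by (rule qF[OF q'])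
    finally show "length ys \<le> length q'" .
  qed
  have no: "\<not> (u \<in> e \<and> v \<in> e)" if uv: "(u, v) \<in> far_ends (shadow F) (\<Union>F)" and e: "e \<in> H" for u v e
  proof
    assume ue: "u \<in> e \<and> v \<in> e"
    from uv obtain q' where q': "longest_path (shadow F) (\<Union>F) q'" "hd q' = u" "last q' = v" and ne: "u \<noteq> v"
      by (auto simp: far_ends_def)
    have closed: "shadow H (last q') (hd q')" using q' ne ue e by (auto simp: shadow_def)
    have "neighbours H C \<noteq> {}" if C: "C \<subset> \<Union>H" "C \<noteq> {}" for C
    proof -
      have "neighbours F C \<noteq> {}" using ec(2)[of C] C UF by simp
      then obtain y where "y \<in> neighbours F C" by blast
      then have "y \<in> neighbours H C" unfolding mem_neighbours using FH by blast
      then show ?thesis by blast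
    qed
    from closing_longest_path[OF symp_shadow inH[OF q'(1)] closed this]
    have setq: "set q' = \<Union>H" .
    have pq': "path_in (shadow H) (\<Union>H) q'" using inH[OF q'(1)] by (simp add: longest_path_def)
    have "3 \<le> card e0" using unif e0 d by auto
    also have "\<dots> \<le> card (\<Union>H)" using e0 finUH by (intro card_mono) auto
    also have "\<dots> = length q'" using pq' setq by (metis path_in_def distinct_card)
    finally have "\<exists>v e. weak_cycle (V, H) (length q') v e \<and> spanned_vertices (length q') v = set q'"
      using weak_cycle_of_path[OF pq' _ _ closed, of V] HPow by auto
    then show False using none setq by auto
  qed
  have "card (X - Q) \<le> card X" using XH finH by (intro card_mono finite_subset[OF XH]) auto
  also have "\<dots> \<le> card P + card (\<Union>v\<in>V. D v)" unfolding X_def by (rule card_Un_le)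
  also have "card (\<Union>v\<in>V. D v) \<le> (\<Sum>v\<in>V. card (D v))" using fin by (rule card_UN_le)
  also have "\<dots> \<le> (\<Sum>v\<in>V. 21 * d)" by (intro sum_mono) (simp add: D(2))
  finally have c1: "card (X - Q) \<le> (21 * d + 1) * card V" using cP by (simp add: algebra_simps)
  have "(card V div 4)\<^sup>2 \<le> card (far_ends (shadow F) (\<Union>F))"
    by (rule card_far_ends[OF finUF symp_shadow ec(1)]) (use pair[of F] e0 in \<open>auto simp: F_def\<close>)
  then show thesis using that[of "X - Q"] XH c1 no unfolding F_def by blast
qed

section \<open>Counting edges that cover given pairs\<close>

declare finite_imp_finite_nsets [simp]

lemma power_le_binomial:
  assumes "k \<le> d" "d \<le> m" "n \<le> 4 * m"
  shows "(real n / (4 * real d)) ^ k \<le> real (m choose k)"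
proof (cases "k = 0")
  case False
  have "real n / (4 * real d) \<le> (4 * real m) / (4 * real k)"
    using assms False by (intro frac_le) auto
  then have "(real n / (4 * real d)) ^ k \<le> (real m / real k) ^ k"
    by (intro power_mono) auto
  also have "\<dots> \<le> real (m choose k)"
    using binomial_ge_n_over_k_pow_k[of k m, where ?'a = real] assms by simp
  finally show ?thesis .
qed simp

lemma card_evens_odds:
  "card {x \<in> {1..n}. even x} = n div 2" "card {x \<in> {1..n}. odd x} = n - n div 2"
proof -
  show ev: "card {x \<in> {1..n}. even x} = n div 2" for n :: nat
  proof (induction n)
    case (Suc n)
    have *: "{x \<in> {1..Suc n}. even x} = (if even (Suc n) then insert (Suc n) {x \<in> {1..n}. even x} else {x \<in> {1..n}. even x})"
      by (auto simp: le_Suc_eq)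
    show ?case unfolding * using Suc by (auto simp: card_insert_if)
  qed simp
  have "card ({x \<in> {1..n}. even x} \<union> {x \<in> {1..n}. odd x})
      = card {x \<in> {1..n}. even x} + card {x \<in> {1..n}. odd x}"
    by (rule card_Un_disjoint) auto
  moreover have "{x \<in> {1..n}. even x} \<union> {x \<in> {1..n}. odd x} = {1..n}" by auto
  ultimately have "n = card {x \<in> {1..n}. even x} + card {x \<in> {1..n}. odd x}" by simp
  then show "card {x \<in> {1..n}. odd x} = n - n div 2" using ev by simp
qed

text \<open>
  The two vertices are completed to an edge by \<open>d - 2\<close> even vertices, or by one odd and \<open>d - 3\<close> even
  vertices, whichever gives the vertex sum the required parity.
\<close>
lemma many_edges_at_pair_of_parity:
  assumes uv: "u \<in> {1..n}" "v \<in> {1..n}" "u \<noteq> v" and d: "d \<ge> 3" and n: "n \<ge> 4 * d + 12"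
  shows "(real n / (4 * real d)) ^ (d - 2) \<le>
    real (card {e \<in> nsets {1..n} d. u \<in> e \<and> v \<in> e \<and> even (\<Sum>e) = b})" (is "_ \<le> real (card ?E)")
proof -
  define Ev where "Ev = {x \<in> {1..n}. even x} - {u, v}"
  define Od where "Od = {x \<in> {1..n}. odd x} - {u, v}"
  have fin: "finite Ev" "finite Od" by (auto simp: Ev_def Od_def)
  have EvV: "Ev \<subseteq> {1..n} - {u, v}" and OdV: "Od \<subseteq> {1..n} - {u, v}" by (auto simp: Ev_def Od_def)
  have "card {x \<in> {1..n}. even x} - card {u, v} \<le> card Ev"
    "card {x \<in> {1..n}. odd x} - card {u, v} \<le> card Od"
    unfolding Ev_def Od_def by (rule diff_card_le_card_Diff; simp)+
  then have "n div 2 - 2 \<le> card Ev" "n - n div 2 - 2 \<le> card Od"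
    using uv card_evens_odds[of n] by auto
  then have cE: "n \<le> 4 * card Ev" "d \<le> card Ev" and cO: "n \<le> 4 * card Od" using n by linarith+
  have finE: "finite ?E" by simp
  have mem: "W \<union> {u, v} \<in> ?E" if "W \<subseteq> {1..n} - {u, v}" "card W = d - 2" "even (\<Sum>W) = (even (u + v) = b)" for W
  proof -
    have fW: "finite W" using that(1) finite_subset by blast
    then have "card (W \<union> {u, v}) = card W + 2" using that(1) uv by (subst card_Un_disjoint) auto
    moreover have "\<Sum>(W \<union> {u, v}) = \<Sum>W + (u + v)"
      using fW that(1) uv by (subst sum.union_disjoint) auto
    ultimately show ?thesis using that d uv fW by (auto simp: nsets_def)
  qed
  show ?thesis
  proof (cases "even (u + v) = b")
    case True
    have evsum: "even (\<Sum>W)" if "W \<subseteq> Ev" for W using that by (intro dvd_sum) (auto simp: Ev_def)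
    have sub: "(\<lambda>W. W \<union> {u, v}) ` nsets Ev (d - 2) \<subseteq> ?E"
    proof
      fix e assume "e \<in> (\<lambda>W. W \<union> {u, v}) ` nsets Ev (d - 2)"
      then obtain W where W: "W \<subseteq> Ev" "card W = d - 2" "e = W \<union> {u, v}" by (auto simp: nsets_def)
      show "e \<in> ?E" unfolding W(3)
        by (rule mem[OF order_trans[OF W(1) EvV] W(2)]) (simp only: True evsum[OF W(1)] simp_thms)
    qed
    then have "card ((\<lambda>W. W \<union> {u, v}) ` nsets Ev (d - 2)) \<le> card ?E" by (rule card_mono[OF finE])
    moreover have "inj_on (\<lambda>W. W \<union> {u, v}) (nsets Ev (d - 2))"
      by (rule inj_onI) (auto simp: nsets_def Ev_def)
    ultimately have "card (nsets Ev (d - 2)) \<le> card ?E" by (simp add: card_image)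
    then have "card Ev choose (d - 2) \<le> card ?E" by simp
    moreover have "(real n / (4 * real d)) ^ (d - 2) \<le> real (card Ev choose (d - 2))"
      using cE by (intro power_le_binomial) auto
    ultimately show ?thesis by linarith
  next
    case False
    let ?f = "\<lambda>(w, W). insert w W \<union> {u, v}"
    have oddsum: "odd (\<Sum>(insert w W))" if "W \<subseteq> Ev" "w \<in> Od" for w W
    proof -
      have "finite W" "w \<notin> W" using that finite_subset[OF _ fin(1)] by (auto simp: Ev_def Od_def)
      moreover have "even (\<Sum>W)" using that(1) by (intro dvd_sum) (auto simp: Ev_def)
      ultimately show ?thesis using that by (simp add: Od_def)
    qed
    have "?f ` (Od \<times> nsets Ev (d - 3)) \<subseteq> ?E"
    proof
      fix e assume "e \<in> ?f ` (Od \<times> nsets Ev (d - 3))"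
      then obtain w W where W: "w \<in> Od" "W \<subseteq> Ev" "card W = d - 3" "e = insert w W \<union> {u, v}"
        by (auto simp: nsets_def)
      have "finite W" "w \<notin> W" using W finite_subset[OF _ fin(1)] by (auto simp: Ev_def Od_def)
      then have "card (insert w W) = d - 2" using W d by simp
      moreover have "insert w W \<subseteq> {1..n} - {u, v}" using W(1,2) EvV OdV by auto
      moreover have "even (\<Sum>(insert w W)) = (even (u + v) = b)" using False oddsum[OF W(2,1)] by simp
      ultimately show "e \<in> ?E" unfolding W(4) by (intro mem)
    qed
    then have "card (?f ` (Od \<times> nsets Ev (d - 3))) \<le> card ?E" by (rule card_mono[OF finE])
    moreover have "inj_on ?f (Od \<times> nsets Ev (d - 3))"
    proof (rule inj_onI)
      fix x y assume "x \<in> Od \<times> nsets Ev (d - 3)" "y \<in> Od \<times> nsets Ev (d - 3)" "?f x = ?f y"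
      then obtain w W w' W' where *: "x = (w, W)" "y = (w', W')" "w \<in> Od" "w' \<in> Od" "W \<subseteq> Ev" "W' \<subseteq> Ev"
        "insert w W \<union> {u, v} = insert w' W' \<union> {u, v}"
        by (auto simp: nsets_def)
      have "{w} = (insert w W \<union> {u, v}) \<inter> Od" "W = (insert w W \<union> {u, v}) \<inter> Ev"
        "{w'} = (insert w' W' \<union> {u, v}) \<inter> Od" "W' = (insert w' W' \<union> {u, v}) \<inter> Ev"
        using *(3-6) by (auto simp: Ev_def Od_def)
      then show "x = y" using *(1,2,7) by (metis singleton_inject)
    qed
    ultimately have "card Od * (card Ev choose (d - 3)) \<le> card ?E"
      by (simp add: card_image card_cartesian_product)
    then have le: "real (card Od) * real (card Ev choose (d - 3)) \<le> real (card ?E)"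
      by (simp only: of_nat_le_iff of_nat_mult[symmetric])
    have "real n / (4 * real d) \<le> real n / 4" using d by (intro divide_left_mono) auto
    also have "\<dots> \<le> real (card Od)" using cO by linarith
    finally have "real n / (4 * real d) * (real n / (4 * real d)) ^ (d - 3)
        \<le> real (card Od) * real (card Ev choose (d - 3))"
      using cE by (intro mult_mono power_le_binomial) auto
    moreover have "d - 2 = Suc (d - 3)" using d by simp
    then have "(real n / (4 * real d)) ^ (d - 2) = real n / (4 * real d) * (real n / (4 * real d)) ^ (d - 3)"
      by (simp only: power_Suc)
    ultimately show ?thesis using le by linarith
  qed
qed

definition edges_covering :: "nat \<Rightarrow> nat \<Rightarrow> bool \<Rightarrow> (nat \<times> nat) set \<Rightarrow> nat set set" where
  "edges_covering d n b P = {e \<in> nsets {1..n} d. even (\<Sum>e) = b \<and> (\<exists>(u, v)\<in>P. u \<in> e \<and> v \<in> e)}"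

definition pair_density :: "nat \<Rightarrow> real" where
  "pair_density d = (1 / (4 * real d)) ^ (d - 2) / (real d)\<^sup>2"

text \<open>
  Double counting: each pair lies in many edges of the required parity, and an edge of size \<open>d\<close>
  contains at most \<open>d\<^sup>2\<close> ordered pairs.
\<close>
lemma card_edges_covering:
  assumes P: "P \<subseteq> {1..n} \<times> {1..n}" "\<And>u v. (u, v) \<in> P \<Longrightarrow> u \<noteq> v" and d: "d \<ge> 3" and n: "n \<ge> 4 * d + 12"
  shows "pair_density d * real (card P) * real n ^ (d - 2) \<le> real (card (edges_covering d n b P))"
proof -
  let ?U = "{e \<in> nsets {1..n} d. even (\<Sum>e) = b}"
  let ?M = "edges_covering d n b P"
  define k where "k = (real n / (4 * real d)) ^ (d - 2)"
  have finP: "finite P" using P(1) finite_subset by blast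
  have finM: "finite ?M" by (simp add: edges_covering_def)
  have "real (card P) * k = (\<Sum>x\<in>P. k)" by simp
  also have "\<dots> \<le> (\<Sum>x\<in>P. real (card {e \<in> ?M. fst x \<in> e \<and> snd x \<in> e}))"
  proof (rule sum_mono)
    fix x assume x: "x \<in> P"
    have "k \<le> real (card {e \<in> nsets {1..n} d. fst x \<in> e \<and> snd x \<in> e \<and> even (\<Sum>e) = b})"
      unfolding k_def using x P by (intro many_edges_at_pair_of_parity[OF _ _ _ d n]) (auto simp: mem_Times_iff)
    also have "{e \<in> nsets {1..n} d. fst x \<in> e \<and> snd x \<in> e \<and> even (\<Sum>e) = b}
        = {e \<in> ?M. fst x \<in> e \<and> snd x \<in> e}"
      using x by (force simp: edges_covering_def)
    finally show "k \<le> real (card {e \<in> ?M. fst x \<in> e \<and> snd x \<in> e})" .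
  qed
  also have "\<dots> = real (\<Sum>x\<in>P. \<Sum>e\<in>?M. if fst x \<in> e \<and> snd x \<in> e then 1 else 0)"
    using finM by (simp add: sum.inter_filter[symmetric])
  also have "(\<Sum>x\<in>P. \<Sum>e\<in>?M. if fst x \<in> e \<and> snd x \<in> e then 1 else 0)
      = (\<Sum>e\<in>?M. card {x \<in> P. fst x \<in> e \<and> snd x \<in> e})"
    using finP by (subst sum.swap) (simp add: sum.inter_filter[symmetric])
  also have "\<dots> \<le> (\<Sum>e\<in>?M. d\<^sup>2)"
  proof (rule sum_mono)
    fix e assume "e \<in> ?M"
    then have e: "finite e" "card e = d" by (auto simp: edges_covering_def nsets_def)
    have "card {x \<in> P. fst x \<in> e \<and> snd x \<in> e} \<le> card (e \<times> e)"
      using e by (intro card_mono) auto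
    then show "card {x \<in> P. fst x \<in> e \<and> snd x \<in> e} \<le> d\<^sup>2"
      using e by (simp add: card_cartesian_product power2_eq_square)
  qed
  also have "\<dots> = card ?M * d\<^sup>2" by simp
  finally have "real (card P) * k \<le> real (card ?M) * (real d)\<^sup>2" by simp
  then have "real (card P) * k / (real d)\<^sup>2 \<le> real (card ?M)"
    using d by (simp add: divide_le_eq)
  then show ?thesis
    by (simp add: pair_density_def k_def power_divide field_simps)
qed

lemma pair_density_pos: "d \<ge> 3 \<Longrightarrow> pair_density d > 0"
  by (simp add: pair_density_def)

section \<open>Random subsets\<close>

definition random_subset :: "'a set \<Rightarrow> real \<Rightarrow> 'a set pmf" where
  "random_subset U p = map_pmf (\<lambda>X. {e \<in> U. X e}) (Pi_pmf U False (\<lambda>_. bernoulli_pmf p))"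

lemma random_hypergraph_eq:
  "random_hypergraph d n p = map_pmf (Pair {1..n}) (random_subset (nsets {1..n} d) p)"
  by (simp add: random_hypergraph_def random_subset_def pmf.map_comp o_def)

lemma set_random_subset: "H \<in> set_pmf (random_subset U p) \<Longrightarrow> H \<subseteq> U"
  by (auto simp: random_subset_def)

text \<open>
  The expectation of \<open>x ^ |H \<inter> D|\<close> on the event \<open>E \<subseteq> H\<close> is a product over the elements, and on the
  event in question this weight is at least \<open>x ^ k\<close>. The case \<open>k = 0\<close>, \<open>x = 0\<close> is the exact
  avoidance of \<open>D\<close>.
\<close>
lemma prob_contains_and_few:
  assumes U: "finite U" "E \<subseteq> U" "D \<subseteq> U" "E \<inter> D = {}" and p: "0 \<le> p" "p \<le> 1" and x: "0 \<le> x" "x \<le> 1"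
  shows "x ^ k * measure_pmf.prob (random_subset U p) {H. E \<subseteq> H \<and> card (H \<inter> D) \<le> k}
    \<le> p ^ card E * (1 - p * (1 - x)) ^ card D"
proof -
  define g :: "'a \<Rightarrow> bool \<Rightarrow> real" where
    "g e b = (if e \<in> E then of_bool b else if e \<in> D then (if b then x else 1) else 1)" for e b
  let ?M = "Pi_pmf U False (\<lambda>_. bernoulli_pmf p)"
  have g0: "g e b \<ge> 0" for e b using x by (simp add: g_def)
  have split: "(\<Prod>e\<in>U. h e) = (\<Prod>e\<in>E. h e) * (\<Prod>e\<in>D. h e)"
    if "\<And>e. e \<in> U - (E \<union> D) \<Longrightarrow> h e = 1" for h :: "'a \<Rightarrow> real"
  proof -
    have "(\<Prod>e\<in>U. h e) = (\<Prod>e\<in>E \<union> D. h e)"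
      using that U by (intro prod.mono_neutral_right) auto
    also have "\<dots> = (\<Prod>e\<in>E. h e) * (\<Prod>e\<in>D. h e)"
      using U finite_subset by (intro prod.union_disjoint) blast+
    finally show ?thesis .
  qed
  have fin: "finite (set_pmf ?M)"
    by (rule finite_subset[OF set_Pi_pmf_subset'[OF U(1)]]) (use U(1) in auto)
  let ?A = "{X. E \<subseteq> {e \<in> U. X e} \<and> card ({e \<in> U. X e} \<inter> D) \<le> k}"
  have "x ^ k * measure_pmf.prob (random_subset U p) {H. E \<subseteq> H \<and> card (H \<inter> D) \<le> k}
      = x ^ k * measure_pmf.prob ?M ?A"
    by (simp add: random_subset_def vimage_def)
  also have "\<dots> = measure_pmf.expectation ?M (\<lambda>X. x ^ k * indicator ?A X)"
    by simp
  also have "\<dots> \<le> measure_pmf.expectation ?M (\<lambda>X. \<Prod>e\<in>U. g e (X e))"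
  proof (rule integral_mono)
    fix X
    show "x ^ k * indicator ?A X \<le> (\<Prod>e\<in>U. g e (X e))"
    proof (cases "X \<in> ?A")
      case True
      have "(\<Prod>e\<in>U. g e (X e)) = (\<Prod>e\<in>E. g e (X e)) * (\<Prod>e\<in>D. g e (X e))"
        by (rule split) (auto simp: g_def)
      also have "(\<Prod>e\<in>E. g e (X e)) = (\<Prod>e\<in>E. 1)" using True by (intro prod.cong) (auto simp: g_def)
      also have "(\<Prod>e\<in>D. g e (X e)) = (\<Prod>e\<in>D. if X e then x else 1)"
        using U by (intro prod.cong) (auto simp: g_def)
      also have "\<dots> = (\<Prod>e\<in>{e\<in>U. X e} \<inter> D. x)"
      proof -
        have "D \<inter> Collect X = {e \<in> U. X e} \<inter> D" "finite D" using U finite_subset by auto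
        then show ?thesis by (simp add: prod.If_cases)
      qed
      finally have "(\<Prod>e\<in>U. g e (X e)) = x ^ card ({e \<in> U. X e} \<inter> D)" by simp
      moreover have "x ^ k \<le> x ^ card ({e \<in> U. X e} \<inter> D)"
        using True x by (intro power_decreasing) auto
      ultimately show ?thesis using True by simp
    qed (simp add: prod_nonneg g0)
  qed (rule integrable_measure_pmf_finite[OF fin])+
  also have "\<dots> = (\<Prod>e\<in>U. measure_pmf.expectation (bernoulli_pmf p) (g e))"
    using U g0 by (intro expectation_prod_Pi_pmf integrable_measure_pmf_finite) auto
  also have "\<dots> = (\<Prod>e\<in>U. p * g e True + (1 - p) * g e False)"
    using p by (intro prod.cong) (auto simp: mult.commute)
  also have "\<dots> = (\<Prod>e\<in>E. p * g e True + (1 - p) * g e False) * (\<Prod>e\<in>D. p * g e True + (1 - p) * g e False)"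
    by (rule split) (auto simp: g_def)
  also have "(\<Prod>e\<in>E. p * g e True + (1 - p) * g e False) = (\<Prod>e\<in>E. p)"
    by (intro prod.cong) (auto simp: g_def)
  also have "(\<Prod>e\<in>D. p * g e True + (1 - p) * g e False) = (\<Prod>e\<in>D. 1 - p * (1 - x))"
    using U by (intro prod.cong) (auto simp: g_def algebra_simps)
  finally show ?thesis by simp
qed

lemma prob_contains_and_avoids:
  assumes "finite U" "E \<subseteq> U" "D \<subseteq> U" "E \<inter> D = {}" "0 \<le> p" "p \<le> 1"
  shows "measure_pmf.prob (random_subset U p) {H. E \<subseteq> H \<and> H \<inter> D = {}}
    \<le> p ^ card E * (1 - p) ^ card D"
proof -
  have "finite D" using assms finite_subset by blast
  then have "{H. E \<subseteq> H \<and> H \<inter> D = {}} = {H. E \<subseteq> H \<and> card (H \<inter> D) \<le> 0}" by auto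
  then show ?thesis using prob_contains_and_few[of U E D p 0 0] assms by simp
qed

lemma prob_contains:
  assumes "finite U" "E \<subseteq> U" "0 \<le> p" "p \<le> 1"
  shows "measure_pmf.prob (random_subset U p) {H. E \<subseteq> H} \<le> p ^ card E"
  using prob_contains_and_avoids[of U E "{}" p] assms by simp

lemma prob_union_bound:
  assumes "finite I" "\<And>H. H \<in> set_pmf M \<Longrightarrow> H \<in> A \<Longrightarrow> \<exists>i\<in>I. H \<in> B i"
    and "\<And>i. i \<in> I \<Longrightarrow> measure_pmf.prob M (B i) \<le> w i"
  shows "measure_pmf.prob M A \<le> (\<Sum>i\<in>I. w i)"
proof -
  have "measure_pmf.prob M A \<le> measure_pmf.prob M (\<Union>i\<in>I. B i)"
    using assms(2) by (intro measure_pmf.finite_measure_mono_AE) (auto simp: AE_measure_pmf_iff)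
  also have "\<dots> \<le> (\<Sum>i\<in>I. measure_pmf.prob M (B i))"
    using assms(1) by (intro measure_pmf.finite_measure_subadditive_finite) auto
  also have "\<dots> \<le> (\<Sum>i\<in>I. w i)" by (intro sum_mono assms(3))
  finally show ?thesis .
qed

lemma sum_Pow_binomial:
  fixes a b :: real
  assumes "finite A"
  shows "(\<Sum>X\<in>Pow A. a ^ card X * b ^ card (A - X)) = (a + b) ^ card A"
  using prod_add[OF assms, of "\<lambda>_. a" "\<lambda>_. b"] by simp

text \<open>
  A union bound over the trace \<open>G = H \<inter> W\<close> and the certificate \<open>F\<close>. Prescribing \<open>G\<close> exactly makes the
  sum over \<open>G\<close> equal to 1, although \<open>D\<close> may depend on \<open>G\<close>. For the sum over \<open>F\<close>, the factor
  \<open>p ^ |F|\<close> is bounded by \<open>(1 / y) ^ M * (y * p) ^ |F|\<close>, so that the binomial theorem applies.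
\<close>
lemma prob_sparse_certificate:
  fixes D :: "'a set \<Rightarrow> 'a set"
  assumes U: "finite U" "W \<subseteq> U" and DU: "\<And>F. D F \<subseteq> U - W"
    and p: "0 \<le> p" "p \<le> 1" and y: "0 < y" "y \<le> 1"
  shows "measure_pmf.prob (random_subset U p)
      {H. \<exists>F. F \<subseteq> H - W \<and> card F \<le> M \<and> m \<le> card (D (H \<inter> W \<union> F)) \<and> H \<inter> D (H \<inter> W \<union> F) = {}}
    \<le> (1 / y) ^ M * (1 + y * p) ^ card U * (1 - p) ^ m" (is "measure_pmf.prob _ ?A \<le> _")
proof -
  define I where "I = {(G, F). G \<subseteq> W \<and> F \<subseteq> U - W \<and> card F \<le> M \<and> m \<le> card (D (G \<union> F))}"
  define w where "w = (\<lambda>(G, F). (p ^ card G * (1 - p) ^ card (W - G)) * (((y * p) ^ card F * 1 ^ card (U - W - F)) * ((1 / y) ^ M * (1 - p) ^ m)))"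
  let ?B = "\<lambda>(G, F). {H. G \<union> F \<subseteq> H \<and> H \<inter> ((W - G) \<union> D (G \<union> F)) = {}}"
  have I: "I \<subseteq> Pow W \<times> Pow (U - W)" by (auto simp: I_def)
  have fW: "finite W" using U finite_subset by blast
  have finPow: "finite (Pow W \<times> Pow (U - W))" using U fW by auto
  have finI: "finite I" by (rule finite_subset[OF I finPow])
  have "measure_pmf.prob (random_subset U p) ?A \<le> (\<Sum>i\<in>I. w i)"
  proof (rule prob_union_bound[OF finI])
    fix H assume H: "H \<in> set_pmf (random_subset U p)" "H \<in> ?A"
    then obtain F where F: "F \<subseteq> H - W" "card F \<le> M" "m \<le> card (D (H \<inter> W \<union> F))" "H \<inter> D (H \<inter> W \<union> F) = {}"
      by blast
    have "(H \<inter> W, F) \<in> I" using F set_random_subset[OF H(1)] by (auto simp: I_def)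
    moreover have "H \<in> ?B (H \<inter> W, F)" using F by auto
    ultimately show "\<exists>i\<in>I. H \<in> ?B i" by blast
  next
    fix i assume "i \<in> I"
    then obtain G F where i: "i = (G, F)" and GF: "G \<subseteq> W" "F \<subseteq> U - W" "card F \<le> M" "m \<le> card (D (G \<union> F))"
      by (auto simp: I_def)
    have fG: "finite G" "finite F" "finite (D (G \<union> F))" using GF U fW DU finite_subset by (meson finite_Diff)+
    have w0: "w i \<ge> 0" using p y unfolding i w_def by (auto intro!: mult_nonneg_nonneg)
    show "measure_pmf.prob (random_subset U p) (?B i) \<le> w i"
    proof (cases "F \<inter> D (G \<union> F) = {}")
      case False
      \<comment> \<open>A certificate cannot be present if it meets the set that is avoided.\<close>
      then have "?B i = {}" unfolding i by auto
      then show ?thesis using w0 by simp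
    next
      case True
      have "measure_pmf.prob (random_subset U p) (?B i)
          \<le> p ^ card (G \<union> F) * (1 - p) ^ card ((W - G) \<union> D (G \<union> F))"
        unfolding i prod.case using GF U True DU[of "G \<union> F"] p
        by (intro prob_contains_and_avoids) auto
      also have "card (G \<union> F) = card G + card F"
        using fG GF by (intro card_Un_disjoint) auto
      also have "card ((W - G) \<union> D (G \<union> F)) = card (W - G) + card (D (G \<union> F))"
        using fG fW DU[of "G \<union> F"] by (intro card_Un_disjoint) auto
      also have "p ^ (card G + card F) * (1 - p) ^ (card (W - G) + card (D (G \<union> F)))
          = (p ^ card G * (1 - p) ^ card (W - G)) * (p ^ card F * (1 - p) ^ card (D (G \<union> F)))"
        by (simp add: power_add)
      also have "\<dots> \<le> (p ^ card G * (1 - p) ^ card (W - G)) * (((y * p) ^ card F * (1 / y) ^ M) * (1 - p) ^ m)"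
      proof (intro mult_left_mono mult_mono)
        have "(1 / y) ^ card F \<le> (1 / y) ^ M" using y GF by (intro power_increasing) auto
        then have "(y * p) ^ card F * (1 / y) ^ card F \<le> (y * p) ^ card F * (1 / y) ^ M"
          using y p by (intro mult_left_mono) auto
        moreover have "(y * p) ^ card F * (1 / y) ^ card F = p ^ card F"
          using y by (simp add: power_mult_distrib power_divide)
        ultimately show "p ^ card F \<le> (y * p) ^ card F * (1 / y) ^ M" by simp
        show "(1 - p) ^ card (D (G \<union> F)) \<le> (1 - p) ^ m" using p GF by (intro power_decreasing) auto
      qed (use p y in auto)
      also have "\<dots> = w i" by (simp add: i w_def mult_ac)
      finally show ?thesis .
    qed
  qed
  also have "\<dots> \<le> (\<Sum>i\<in>Pow W \<times> Pow (U - W). w i)"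
    using p y by (intro sum_mono2 finPow I) (auto simp: w_def intro!: mult_nonneg_nonneg)
  also have "\<dots> = (\<Sum>G\<in>Pow W. p ^ card G * (1 - p) ^ card (W - G)) *
      (\<Sum>F\<in>Pow (U - W). ((y * p) ^ card F * 1 ^ card (U - W - F)) * ((1 / y) ^ M * (1 - p) ^ m))"
    unfolding w_def by (simp only: sum_product sum.cartesian_product)
  also have "\<dots> = (1 + y * p) ^ card (U - W) * ((1 / y) ^ M * (1 - p) ^ m)"
    using U fW by (simp only: sum_distrib_right[symmetric] sum_Pow_binomial finite_Diff) (simp add: add.commute)
  also have "\<dots> \<le> (1 + y * p) ^ card U * ((1 / y) ^ M * (1 - p) ^ m)"
    using p y U by (intro mult_right_mono power_increasing card_mono) auto
  finally show ?thesis by (simp add: mult_ac)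
qed

section \<open>Probability that low degrees are close or small sets are dense\<close>

lemma power_le_fact: "(real m / 3) ^ m \<le> fact m"
proof (induction m)
  case (Suc m)
  show ?case
  proof (cases "m = 0")
    case False
    have "(1 + 1 / real m) ^ m \<le> exp (1 / real m) ^ m" by (intro power_mono) auto
    also have "\<dots> = exp 1" using False by (simp flip: exp_of_nat_mult)
    also have "\<dots> \<le> 3" by (rule exp_le)
    finally have e: "(1 + 1 / real m) ^ m \<le> 3" .
    have "real (Suc m) / 3 = (real m / 3) * (1 + 1 / real m)" using False by (simp add: field_simps)
    then have "(real (Suc m) / 3) ^ m = (real m / 3) ^ m * (1 + 1 / real m) ^ m"
      by (metis power_mult_distrib)
    then have "(real (Suc m) / 3) ^ Suc m = real (Suc m) / 3 * ((real m / 3) ^ m * (1 + 1 / real m) ^ m)"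
      by (simp only: power_Suc)
    also have "\<dots> \<le> real (Suc m) / 3 * (fact m * 3)"
      using Suc e by (intro mult_left_mono mult_mono) auto
    also have "\<dots> = fact (Suc m)" by (simp add: field_simps)
    finally show ?thesis .
  qed simp
qed simp

lemma binomial_le_power: "m > 0 \<Longrightarrow> real (n choose m) \<le> (3 * real n / real m) ^ m"
proof -
  assume m: "m > 0"
  have "real (n choose m) * (real m / 3) ^ m \<le> real (n choose m) * fact m"
    by (intro mult_left_mono power_le_fact) auto
  also have "\<dots> \<le> real n ^ m"
    using binomial_fact_pow[of n m] by (metis of_nat_fact of_nat_le_iff of_nat_mult of_nat_power)
  finally have "real (n choose m) \<le> real n ^ m / (real m / 3) ^ m" using m by (simp add: pos_le_divide_eq)
  also have "\<dots> = (3 * real n / real m) ^ m" by (simp flip: power_divide add: mult.commute)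
  finally show ?thesis .
qed

lemma sum_arith_geometric: "(\<Sum>i\<in>{1..t}. real i * (1 / 2) ^ (i - 1)) = 4 - 2 * (real t + 2) * (1 / 2) ^ t"
  by (induction t) (simp_all add: algebra_simps add_divide_distrib)

lemma binomial_le_self_power: "n choose k \<le> n ^ k"
  by (cases "k \<le> n") (auto simp: binomial_le_pow binomial_eq_0)

lemma sum_nested_Sigma:
  assumes "finite A" "\<And>a. a \<in> A \<Longrightarrow> finite (B a)" "\<And>a b. a \<in> A \<Longrightarrow> b \<in> B a \<Longrightarrow> finite (C a b)"
  shows "(\<Sum>(a, b, c)\<in>(SIGMA a:A. SIGMA b:B a. C a b). f a b c) = (\<Sum>a\<in>A. \<Sum>b\<in>B a. \<Sum>c\<in>C a b. f a b c)"
proof -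
  have "(\<Sum>a\<in>A. \<Sum>b\<in>B a. \<Sum>c\<in>C a b. f a b c) = (\<Sum>a\<in>A. \<Sum>(b, c)\<in>(SIGMA b:B a. C a b). f a b c)"
    using assms by (intro sum.cong refl sum.Sigma) auto
  also have "\<dots> = (\<Sum>(a, b, c)\<in>(SIGMA a:A. SIGMA b:B a. C a b). f a b c)"
    using assms by (intro sum.Sigma) auto
  finally show ?thesis by simp
qed

text \<open>
  First moment over sets \<open>T\<close> of size \<open>k\<close> and sets of \<open>3 k\<close> edges inside \<open>T\<close>. For one \<open>k\<close> the expected
  number is at most \<open>(3 n / k * (k ^ (d - 1) * p) ^ 3) ^ k\<close>. As \<open>d - 1 \<ge> 2\<close>, the base is at most
  \<open>3 * lam ^ 3 * (k / n) ^ 5\<close>, and the bound on \<open>t\<close> turns this into \<open>3 k / n \<le> 1 / 2\<close>.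
\<close>
lemma prob_not_locally_sparse:
  assumes d: "d \<ge> 3" and p: "0 \<le> p" "p \<le> 1" and lam: "p * real n ^ (d - 1) \<le> lam"
    and t: "lam ^ 3 * (real t / real n) ^ 4 \<le> 1" "6 * t \<le> n" and n: "n > 0"
  shows "measure_pmf.prob (random_subset (nsets {1..n} d) p) {H. \<not> locally_sparse t H} \<le> 12 / real n"
proof -
  let ?V = "{1..n}" and ?U = "nsets {1..n} d"
  define I where "I = (SIGMA k:{1..t}. SIGMA T:nsets ?V k. nsets (nsets T d) (3 * k))"
  have finT: "finite T" if "T \<in> nsets ?V k" for T k using that by (auto simp: nsets_def)
  have "measure_pmf.prob (random_subset ?U p) {H. \<not> locally_sparse t H}
      \<le> (\<Sum>i\<in>I. (\<lambda>(k, T, E). p ^ (3 * k)) i)"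
  proof (rule prob_union_bound[where B = "\<lambda>(k, T, E). {H. E \<subseteq> H}"])
    show "finite I" unfolding I_def using finT by (intro finite_SigmaI) auto
  next
    fix H assume "H \<in> set_pmf (random_subset ?U p)" "H \<in> {H. \<not> locally_sparse t H}"
    then obtain T where HU: "H \<subseteq> ?U" and T: "finite T" "T \<noteq> {}" "card T \<le> t" "3 * card T \<le> card {e \<in> H. e \<subseteq> T}"
      by (auto simp: locally_sparse_def not_less dest!: set_random_subset)
    define T' where "T' = T \<inter> ?V"
    have eq: "{e \<in> H. e \<subseteq> T} = {e \<in> H. e \<subseteq> T'}" using HU by (auto simp: T'_def nsets_def)
    have "T' \<noteq> {}"
    proof
      assume "T' = {}"
      then have none: "{e \<in> H. e \<subseteq> T} = {}" unfolding eq using HU d by (auto simp: nsets_def)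
      show False using T unfolding none by (simp add: card_gt_0_iff)
    qed
    then have k: "card T' \<in> {1..t}" using T card_mono[of T T'] by (auto simp: T'_def Suc_le_eq card_gt_0_iff)
    have "card T' \<le> card T" using T by (intro card_mono) (auto simp: T'_def)
    then have "3 * card T' \<le> card {e \<in> H. e \<subseteq> T'}" using T(4) unfolding eq by linarith
    then obtain E where E: "E \<subseteq> {e \<in> H. e \<subseteq> T'}" "card E = 3 * card T'" "finite E"
      by (rule obtain_subset_with_card_n)
    have "T' \<in> nsets ?V (card T')" by (auto simp: nsets_def T'_def)
    moreover have "E \<in> nsets (nsets T' d) (3 * card T')" using E HU by (fastforce simp: nsets_def)
    ultimately have "(card T', T', E) \<in> I" using k by (auto simp: I_def)
    then show "\<exists>i\<in>I. H \<in> (case i of (k, T, E) \<Rightarrow> {H. E \<subseteq> H})"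
      using E(1) by (intro bexI[of _ "(card T', T', E)"]) auto
  next
    fix i assume "i \<in> I"
    then obtain k T E where i: "i = (k, T, E)" and T: "T \<in> nsets ?V k" and E: "E \<in> nsets (nsets T d) (3 * k)"
      by (auto simp: I_def)
    have TV: "T \<subseteq> ?V" using T by (simp add: nsets_def)
    have "E \<subseteq> nsets T d" "card E = 3 * k" using E by (simp_all add: nsets_def[of "nsets T d"])
    then have "E \<subseteq> ?U" "card E = 3 * k" using nsets_mono[OF TV] by (blast, simp)
    then show "measure_pmf.prob (random_subset ?U p) (case i of (k, T, E) \<Rightarrow> {H. E \<subseteq> H}) \<le> (case i of (k, T, E) \<Rightarrow> p ^ (3 * k))"
      using prob_contains[of ?U E p] p by (simp add: i)
  qed
  also have "(\<Sum>i\<in>I. (\<lambda>(k, T, E). p ^ (3 * k)) i)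
      = (\<Sum>k\<in>{1..t}. \<Sum>T\<in>nsets ?V k. \<Sum>E\<in>nsets (nsets T d) (3 * k). p ^ (3 * k))"
    unfolding I_def using finT by (intro sum_nested_Sigma) auto
  also have "\<dots> = (\<Sum>k\<in>{1..t}. \<Sum>T\<in>nsets ?V k. real ((k choose d) choose (3 * k)) * p ^ (3 * k))"
    by (intro sum.cong refl) (auto simp: nsets_def[of "{Suc 0..n}"])
  also have "\<dots> = (\<Sum>k\<in>{1..t}. real (n choose k) * (real ((k choose d) choose (3 * k)) * p ^ (3 * k)))"
    by simp
  also have "\<dots> \<le> (\<Sum>k\<in>{1..t}. 3 / real n * (real k * (1 / 2) ^ (k - 1)))"
  proof (rule sum_mono)
    fix k assume "k \<in> {1..t}"
    then have k: "k > 0" "k \<le> t" by auto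
    then have kn: "k \<le> n" using t(2) by linarith
    define q where "q = real k / real n"
    have q: "0 \<le> q" "q \<le> 1" using kn n by (auto simp: q_def)
    have "real ((k choose d) choose (3 * k)) \<le> (3 * real (k choose d) / real (3 * k)) ^ (3 * k)"
      using k by (intro binomial_le_power) auto
    also have "\<dots> \<le> (real k ^ (d - 1)) ^ (3 * k)"
    proof (intro power_mono)
      have "real (k choose d) \<le> real k ^ d" using binomial_le_self_power[of k d] by (metis of_nat_le_iff of_nat_power)
      also have "\<dots> = real k ^ (d - 1) * real k" using d by (metis Suc_diff_1 power_Suc2 gr0I not_numeral_le_zero)
      finally show "3 * real (k choose d) / real (3 * k) \<le> real k ^ (d - 1)" using k by (simp add: divide_le_eq)
    qed simp
    finally have b2: "real ((k choose d) choose (3 * k)) \<le> (real k ^ (d - 1)) ^ (3 * k)" .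
    have "real k ^ (d - 1) * p = p * real n ^ (d - 1) * q ^ (d - 1)"
      using n by (simp add: q_def power_divide)
    also have "\<dots> \<le> lam * q ^ 2"
    proof (rule mult_mono)
      show "q ^ (d - 1) \<le> q ^ 2" using q d by (intro power_decreasing) auto
      show "0 \<le> lam" using lam p by (meson mult_nonneg_nonneg of_nat_0_le_iff order_trans zero_le_power)
    qed (use lam q in auto)
    finally have kp: "real k ^ (d - 1) * p \<le> lam * q ^ 2" .
    have lam0: "0 \<le> lam" using lam p by (meson mult_nonneg_nonneg of_nat_0_le_iff order_trans zero_le_power)
    have "(real k / real n) ^ 4 \<le> (real t / real n) ^ 4" using k by (intro power_mono divide_right_mono) auto
    then have "lam ^ 3 * q ^ 4 \<le> lam ^ 3 * (real t / real n) ^ 4"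
      unfolding q_def using lam0 by (intro mult_left_mono) auto
    then have l1: "lam ^ 3 * q ^ 4 \<le> 1" using t(1) by linarith
    have "real (n choose k) * (real ((k choose d) choose (3 * k)) * p ^ (3 * k))
        \<le> (3 * real n / real k) ^ k * ((real k ^ (d - 1)) ^ (3 * k) * p ^ (3 * k))"
      using b2 k p by (intro mult_mono binomial_le_power) auto
    also have "\<dots> = (3 * real n / real k * (real k ^ (d - 1) * p) ^ 3) ^ k"
      by (simp only: power_mult_distrib power_mult)
    also have "\<dots> \<le> (3 * q) ^ k"
    proof (rule power_mono)
      have "3 * real n / real k * (real k ^ (d - 1) * p) ^ 3 \<le> 3 * real n / real k * (lam * q ^ 2) ^ 3"
        using kp p by (intro mult_left_mono power_mono) auto
      also have "\<dots> = 3 * (real n / real k) * q * (lam ^ 3 * q ^ 4) * q"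
        by (simp add: power_mult_distrib eval_nat_numeral)
      also have "\<dots> = 3 * (lam ^ 3 * q ^ 4) * q" using k n by (simp add: q_def)
      also have "\<dots> \<le> 3 * 1 * q" using l1 q by (intro mult_right_mono) auto
      finally show "3 * real n / real k * (real k ^ (d - 1) * p) ^ 3 \<le> 3 * q" by simp
    qed (use p in auto)
    also have "\<dots> = (3 * q) * (3 * q) ^ (k - 1)" using k by (metis Suc_diff_1 power_Suc)
    also have "\<dots> \<le> (3 * q) * (1 / 2) ^ (k - 1)"
    proof (intro mult_left_mono power_mono)
      have "real (6 * k) \<le> real n" using k t(2) by linarith
      then show "3 * q \<le> 1 / 2" using n by (simp add: q_def field_simps)
    qed (use q in auto)
    finally show "real (n choose k) * (real ((k choose d) choose (3 * k)) * p ^ (3 * k))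
        \<le> 3 / real n * (real k * (1 / 2) ^ (k - 1))" by (simp add: q_def)
  qed
  also have "\<dots> = 3 / real n * (4 - 2 * (real t + 2) * (1 / 2) ^ t)"
    by (simp only: sum_distrib_left[symmetric] sum_arith_geometric)
  also have "\<dots> \<le> 3 / real n * 4" by (intro mult_left_mono) auto
  finally show ?thesis by simp
qed

definition chain_lists :: "'a set set \<Rightarrow> 'a \<Rightarrow> nat \<Rightarrow> 'a set list set" where
  "chain_lists U u k = {es. set es \<subseteq> U \<and> length es = k \<and> chain u es}"

lemma finite_chain_lists: "finite U \<Longrightarrow> finite (chain_lists U u k)"
  unfolding chain_lists_def by (rule finite_subset[OF _ finite_lists_length_eq[of U k]]) auto

lemma card_edges_at_le:
  assumes "finite V" "d > 0"
  shows "card {e \<in> nsets V d. v \<in> e} \<le> card V ^ (d - 1)"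
proof -
  have "{e \<in> nsets V d. v \<in> e} \<subseteq> insert v ` nsets V (d - 1)"
  proof
    fix e assume e: "e \<in> {e \<in> nsets V d. v \<in> e}"
    then have "e - {v} \<in> nsets V (d - 1)" "e = insert v (e - {v})" by (auto simp: nsets_def)
    then show "e \<in> insert v ` nsets V (d - 1)" by blast
  qed
  then have "card {e \<in> nsets V d. v \<in> e} \<le> card (nsets V (d - 1))"
    using assms by (intro surj_card_le) auto
  also have "\<dots> \<le> card V ^ (d - 1)" using binomial_le_self_power by simp
  finally show ?thesis .
qed

text \<open>
  By induction on the length: an edge put in front of a chain either occurs in it already, at no
  further cost, or it is new, costs a factor \<open>p\<close>, and meets one of the \<open>d\<close> vertices of the first
  edge. Counting repetitions this way avoids reducing chains to repetition-free ones.
\<close>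
lemma chain_weight:
  assumes V: "finite V" and d: "d > 0" and p: "0 \<le> p"
  shows "(\<Sum>es\<in>chain_lists (nsets V d) u (Suc k). p ^ card (set es))
    \<le> (real (Suc k) + real d * (p * real (card V) ^ (d - 1))) ^ Suc k"
proof (induction k)
  let ?U = "nsets V d"
  define c where "c = p * real (card V) ^ (d - 1)"
  have c: "0 \<le> c" using p by (simp add: c_def)
  have at: "p * real (card {e \<in> ?U. v \<in> e}) \<le> c" for v
    unfolding c_def using card_edges_at_le[OF V d, of v] p
    by (intro mult_left_mono) (metis of_nat_le_iff of_nat_power, simp)
  {
    case 0
    have "chain_lists ?U u (Suc 0) = (\<lambda>e. [e]) ` {e \<in> ?U. u \<in> e}"
      by (auto simp: chain_lists_def length_Suc_conv)
    then have "(\<Sum>es\<in>chain_lists ?U u (Suc 0). p ^ card (set es)) = p * real (card {e \<in> ?U. u \<in> e})"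
      by (simp add: sum.reindex inj_on_def mult.commute)
    also have "\<dots> \<le> c" by (rule at)
    also have "\<dots> \<le> 1 + real d * c" using d c by (simp add: add_increasing mult_le_cancel_right1)
    finally show ?case by (simp add: c_def)
  next
    case (Suc k)
    let ?S = "SIGMA es:chain_lists ?U u (Suc k). {f \<in> ?U. f \<inter> hd es \<noteq> {}}"
    have eq: "chain_lists ?U u (Suc (Suc k)) = (\<lambda>(es, f). f # es) ` ?S"
    proof
      show "chain_lists ?U u (Suc (Suc k)) \<subseteq> (\<lambda>(es, f). f # es) ` ?S"
      proof
        fix es assume "es \<in> chain_lists ?U u (Suc (Suc k))"
        then obtain f e es' where "es = f # e # es'" "set es \<subseteq> ?U" "length es' = k" "chain u es"
          by (auto simp: chain_lists_def length_Suc_conv)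
        then show "es \<in> (\<lambda>(es, f). f # es) ` ?S"
          by (intro image_eqI[of _ _ "(e # es', f)"]) (auto simp: chain_lists_def)
      qed
      show "(\<lambda>(es, f). f # es) ` ?S \<subseteq> chain_lists ?U u (Suc (Suc k))"
        by (auto simp: chain_lists_def length_Suc_conv)
    qed
    have inner: "(\<Sum>f\<in>{f \<in> ?U. f \<inter> hd es \<noteq> {}}. p ^ card (set (f # es)))
        \<le> p ^ card (set es) * (real (Suc k) + real d * c)" if es: "es \<in> chain_lists ?U u (Suc k)" for es
    proof -
      let ?A = "{f \<in> ?U. f \<inter> hd es \<noteq> {}}"
      have "es \<noteq> []" using es by (auto simp: chain_lists_def)
      then have hd: "finite (hd es)" "card (hd es) = d" using es hd_in_set
        by (fastforce simp: chain_lists_def nsets_def)+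
      have "(\<Sum>f\<in>?A. p ^ card (set (f # es)))
          \<le> (\<Sum>f\<in>?A. (if f \<in> set es then p ^ card (set es) else 0) + p ^ card (set es) * p)"
        using p by (intro sum_mono) (auto simp: insert_absorb)
      also have "\<dots> = real (card (?A \<inter> set es)) * p ^ card (set es) + p ^ card (set es) * (p * real (card ?A))"
        using V by (simp add: sum.distrib sum.If_cases Int_def conj_commute)
      also have "\<dots> \<le> real (Suc k) * p ^ card (set es) + p ^ card (set es) * (real d * c)"
      proof (intro add_mono mult_left_mono mult_right_mono)
        have "card (?A \<inter> set es) \<le> card (set es)" by (intro card_mono) auto
        also have "\<dots> \<le> Suc k" using es card_length[of es] by (simp add: chain_lists_def)
        finally show "real (card (?A \<inter> set es)) \<le> real (Suc k)" by simp
        have "?A = (\<Union>v\<in>hd es. {e \<in> ?U. v \<in> e})" by auto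
        then have "card ?A \<le> (\<Sum>v\<in>hd es. card {e \<in> ?U. v \<in> e})" using hd(1) by (simp add: card_UN_le)
        then have "p * real (card ?A) \<le> p * real (\<Sum>v\<in>hd es. card {e \<in> ?U. v \<in> e})"
          using p by (intro mult_left_mono of_nat_mono)
        also have "\<dots> = (\<Sum>v\<in>hd es. p * real (card {e \<in> ?U. v \<in> e}))" by (simp add: sum_distrib_left)
        also have "\<dots> \<le> (\<Sum>v\<in>hd es. c)" by (intro sum_mono at)
        finally show "p * real (card ?A) \<le> real d * c" using hd by simp
      qed (use p in auto)
      finally show ?thesis by (simp add: algebra_simps)
    qed
    have "(\<Sum>es\<in>chain_lists ?U u (Suc (Suc k)). p ^ card (set es))
        = (\<Sum>(es, f)\<in>?S. p ^ card (set (f # es)))"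
      unfolding eq by (subst sum.reindex) (auto simp: inj_on_def case_prod_unfold)
    also have "\<dots> = (\<Sum>es\<in>chain_lists ?U u (Suc k). \<Sum>f\<in>{f \<in> ?U. f \<inter> hd es \<noteq> {}}. p ^ card (set (f # es)))"
      using V by (subst sum.Sigma) (auto simp: finite_chain_lists)
    also have "\<dots> \<le> (\<Sum>es\<in>chain_lists ?U u (Suc k). p ^ card (set es) * (real (Suc k) + real d * c))"
      by (intro sum_mono inner)
    also have "\<dots> = (\<Sum>es\<in>chain_lists ?U u (Suc k). p ^ card (set es)) * (real (Suc k) + real d * c)"
      by (simp add: sum_distrib_right)
    also have "\<dots> \<le> (real (Suc k) + real d * c) ^ Suc k * (real (Suc k) + real d * c)"
      using Suc c by (intro mult_right_mono) (auto simp: c_def)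
    also have "\<dots> = (real (Suc k) + real d * c) ^ Suc (Suc k)" by simp
    also have "\<dots> \<le> (real (Suc (Suc k)) + real d * c) ^ Suc (Suc k)"
      using c by (intro power_mono) auto
    finally show ?case by (simp only: c_def)
  }
qed

lemma chain_start: "chain u es \<Longrightarrow> u \<in> \<Union>(set es)"
  by (induction u es rule: chain.induct) auto

lemma card_edges_at_pair:
  assumes "finite V" "u \<in> V" "w \<in> V" "u \<noteq> w" "d > 0"
  shows "2 * ((card V - 2) choose (d - 1)) \<le> card {e \<in> nsets V d. u \<in> e \<or> w \<in> e}"
proof -
  let ?W = "nsets (V - {u, w}) (d - 1)"
  have cV: "card (V - {u, w}) = card V - 2" using assms by (simp add: card_Diff_subset)
  have inj: "inj_on (insert x) ?W" if "x = u \<or> x = w" for x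
    using that by (intro inj_onI) (auto simp: nsets_def insert_eq_iff)
  have "2 * ((card V - 2) choose (d - 1)) = card (insert u ` ?W) + card (insert w ` ?W)"
    using inj cV by (simp add: card_image)
  also have "\<dots> = card (insert u ` ?W \<union> insert w ` ?W)"
    using assms by (intro card_Un_disjoint[symmetric]) (auto simp: nsets_def)
  also have "\<dots> \<le> card {e \<in> nsets V d. u \<in> e \<or> w \<in> e}"
    using assms by (intro card_mono) (auto simp: nsets_def card_insert_if)
  finally show ?thesis .
qed

text \<open>
  First moment over chains between two vertices. Given the edges of the chain, both vertices have
  low degree only if few of about \<open>2 * ((n - 2) choose (d - 1))\<close> further potential edges are present.
\<close>
lemma prob_not_low_degrees_apart:
  assumes d: "d \<ge> 3" and p: "0 \<le> p" "p \<le> 1" and lam: "p * real n ^ (d - 1) \<le> lam"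
    and x: "0 < x" "x \<le> 1"
  shows "measure_pmf.prob (random_subset (nsets {1..n} d) p) {H. \<not> low_degrees_apart K H}
    \<le> real n * real d * (4 + real d * lam) ^ 4 * (1 / x) ^ (2 * K) *
       exp (- p * (1 - x) * (2 * real ((n - 2) choose (d - 1)) - 4))"
proof -
  let ?V = "{1..n}" and ?U = "nsets {1..n} d"
  \<comment> \<open>The subtracted 4 accounts for the edges of the chain.\<close>
  define m where "m = 2 * ((n - 2) choose (d - 1)) - 4"
  define R where "R = (1 / x) ^ (2 * K) * (1 - p * (1 - x)) ^ m"
  have px: "0 \<le> 1 - p * (1 - x)" "1 - p * (1 - x) \<le> 1"
    using p x mult_le_one[of p "1 - x"] by auto
  have R0: "R \<ge> 0" using x px by (simp add: R_def)
  define I where "I = (SIGMA u:?V. SIGMA es:chain_lists ?U u 4. hd es - {u})"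
  define D where "D = (\<lambda>(u, es, w). {e \<in> ?U. u \<in> e \<or> w \<in> e} - set es)"
  have hd: "finite (hd es)" "card (hd es) = d" "hd es \<subseteq> ?V" if "es \<in> chain_lists ?U u 4" for es u
  proof -
    have "es \<noteq> []" "set es \<subseteq> ?U" using that by (auto simp: chain_lists_def)
    then have "hd es \<in> ?U" using hd_in_set[of es] by blast
    then show "finite (hd es)" "card (hd es) = d" "hd es \<subseteq> ?V" by (auto simp: nsets_def)
  qed
  have "measure_pmf.prob (random_subset ?U p) {H. \<not> low_degrees_apart K H}
      \<le> (\<Sum>i\<in>I. (\<lambda>(u, es, w). p ^ card (set es) * R) i)"
  proof (rule prob_union_bound[where B = "\<lambda>(u, es, w). {H. set es \<subseteq> H \<and> card (H \<inter> D (u, es, w)) \<le> 2 * K}"])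
    show "finite I" unfolding I_def using hd by (intro finite_SigmaI) (auto simp: finite_chain_lists)
  next
    fix H assume "H \<in> set_pmf (random_subset ?U p)" "H \<in> {H. \<not> low_degrees_apart K H}"
    then obtain u w es where HU: "H \<subseteq> ?U" and es: "chain u es" "set es \<subseteq> H" "length es = 4" "w \<in> hd es"
      "edge_deg H u < K" "edge_deg H w < K" "u \<noteq> w"
      by (auto simp: low_degrees_apart_def dest!: set_random_subset)
    have "u \<in> ?V" using chain_start[OF es(1)] es(2) HU by (fastforce simp: nsets_def)
    then have "(u, es, w) \<in> I" using es HU by (auto simp: I_def chain_lists_def)
    moreover have "card (H \<inter> D (u, es, w)) \<le> 2 * K"
    proof -
      have finH: "finite H" using HU finite_subset by fastforce
      have "card (H \<inter> D (u, es, w)) \<le> card ({e \<in> H. u \<in> e} \<union> {e \<in> H. w \<in> e})"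
        using finH by (intro card_mono) (auto simp: D_def)
      also have "\<dots> \<le> edge_deg H u + edge_deg H w" unfolding edge_deg_def by (rule card_Un_le)
      finally show ?thesis using es by linarith
    qed
    ultimately show "\<exists>i\<in>I. H \<in> (case i of (u, es, w) \<Rightarrow> {H. set es \<subseteq> H \<and> card (H \<inter> D (u, es, w)) \<le> 2 * K})"
      using es(2) by (intro bexI[of _ "(u, es, w)"]) auto
  next
    fix i assume "i \<in> I"
    then obtain u es w where i: "i = (u, es, w)" and u: "u \<in> ?V" and es: "es \<in> chain_lists ?U u 4"
      and w: "w \<in> hd es" "w \<noteq> u" unfolding I_def by blast
    have wV: "w \<in> ?V" using w hd(3)[OF es] by blast
    have esU: "set es \<subseteq> ?U" "length es = 4" using es by (auto simp: chain_lists_def)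
    have "card {e \<in> ?U. u \<in> e \<or> w \<in> e} - card (set es) \<le> card (D (u, es, w))"
      unfolding D_def prod.case by (rule diff_card_le_card_Diff) simp
    moreover have "2 * ((n - 2) choose (d - 1)) \<le> card {e \<in> ?U. u \<in> e \<or> w \<in> e}"
      using card_edges_at_pair[of ?V u w d] u wV w d by simp
    moreover have "card (set es) \<le> 4" using esU card_length[of es] by simp
    ultimately have "m \<le> card (D (u, es, w))" unfolding m_def by linarith
    then have "(1 - p * (1 - x)) ^ card (D (u, es, w)) \<le> (1 - p * (1 - x)) ^ m"
      using px by (intro power_decreasing) auto
    moreover have "x ^ (2 * K) * measure_pmf.prob (random_subset ?U p) {H. set es \<subseteq> H \<and> card (H \<inter> D (u, es, w)) \<le> 2 * K}
        \<le> p ^ card (set es) * (1 - p * (1 - x)) ^ card (D (u, es, w))"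
      using esU p x by (intro prob_contains_and_few) (auto simp: D_def)
    ultimately have "x ^ (2 * K) * measure_pmf.prob (random_subset ?U p) {H. set es \<subseteq> H \<and> card (H \<inter> D (u, es, w)) \<le> 2 * K}
        \<le> p ^ card (set es) * (1 - p * (1 - x)) ^ m"
      using p by (meson mult_left_mono order_trans zero_le_power)
    then have "measure_pmf.prob (random_subset ?U p) {H. set es \<subseteq> H \<and> card (H \<inter> D (u, es, w)) \<le> 2 * K}
        \<le> p ^ card (set es) * (1 - p * (1 - x)) ^ m / x ^ (2 * K)"
      using x by (simp add: pos_le_divide_eq mult.commute)
    then show "measure_pmf.prob (random_subset ?U p) (case i of (u, es, w) \<Rightarrow> {H. set es \<subseteq> H \<and> card (H \<inter> D (u, es, w)) \<le> 2 * K})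
        \<le> (case i of (u, es, w) \<Rightarrow> p ^ card (set es) * R)"
      by (simp add: i R_def power_divide)
  qed
  also have "(\<Sum>i\<in>I. (\<lambda>(u, es, w). p ^ card (set es) * R) i)
      = (\<Sum>u\<in>?V. \<Sum>es\<in>chain_lists ?U u 4. \<Sum>w\<in>hd es - {u}. p ^ card (set es) * R)"
    unfolding I_def using hd(1) by (intro sum_nested_Sigma) (auto simp: finite_chain_lists)
  also have "\<dots> \<le> (\<Sum>u\<in>?V. \<Sum>es\<in>chain_lists ?U u 4. real d * R * p ^ card (set es))"
  proof (intro sum_mono)
    fix u es assume es: "es \<in> chain_lists ?U u 4"
    have "card (hd es - {u}) \<le> d" using hd[OF es] by (metis card_Diff1_le)
    then have "real (card (hd es - {u})) * (p ^ card (set es) * R) \<le> real d * (p ^ card (set es) * R)"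
      using p R0 by (intro mult_right_mono) auto
    then show "(\<Sum>w\<in>hd es - {u}. p ^ card (set es) * R) \<le> real d * R * p ^ card (set es)"
      by (simp add: mult_ac)
  qed
  also have "\<dots> \<le> (\<Sum>u\<in>?V. real d * R * (4 + real d * lam) ^ 4)"
  proof (rule sum_mono)
    fix u
    have "(\<Sum>es\<in>chain_lists ?U u 4. p ^ card (set es)) \<le> (4 + real d * (p * real n ^ (d - 1))) ^ 4"
      using chain_weight[of ?V d p u 3] d p(1) by (simp add: numeral_eq_Suc)
    also have "\<dots> \<le> (4 + real d * lam) ^ 4"
      using lam p by (intro power_mono add_left_mono mult_left_mono) auto
    finally show "(\<Sum>es\<in>chain_lists ?U u 4. real d * R * p ^ card (set es)) \<le> real d * R * (4 + real d * lam) ^ 4"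
      using R0 by (simp add: sum_distrib_left[symmetric] mult_left_mono)
  qed
  also have "\<dots> = real n * real d * (4 + real d * lam) ^ 4 * R" by simp
  also have "\<dots> \<le> real n * real d * (4 + real d * lam) ^ 4 *
      ((1 / x) ^ (2 * K) * exp (- p * (1 - x) * (2 * real ((n - 2) choose (d - 1)) - 4)))"
  proof -
    have "(1 - p * (1 - x)) ^ m \<le> exp (- (p * (1 - x))) ^ m"
      using px exp_ge_add_one_self[of "- (p * (1 - x))"] by (intro power_mono) auto
    also have "\<dots> = exp (- (p * (1 - x)) * real m)" by (simp flip: exp_of_nat2_mult)
    also have "\<dots> \<le> exp (- (p * (1 - x)) * (2 * real ((n - 2) choose (d - 1)) - 4))"
    proof -
      have "2 * real ((n - 2) choose (d - 1)) - 4 \<le> real m" unfolding m_def by linarith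
      then have "p * (1 - x) * (2 * real ((n - 2) choose (d - 1)) - 4) \<le> p * (1 - x) * real m"
        using p x by (intro mult_left_mono) auto
      then show ?thesis by simp
    qed
    finally have "R \<le> (1 / x) ^ (2 * K) * exp (- p * (1 - x) * (2 * real ((n - 2) choose (d - 1)) - 4))"
      unfolding R_def using x by (intro mult_left_mono) auto
    then show ?thesis by (intro mult_left_mono) auto
  qed
  finally show ?thesis by (simp add: mult_ac)
qed

section \<open>Probability that even edges fail to join large sets or boosters are missing\<close>

abbreviation even_edges :: "nat \<Rightarrow> nat \<Rightarrow> nat set set" where
  "even_edges d n \<equiv> {e \<in> nsets {1..n} d. even (\<Sum>e)}"

lemma power_one_minus_le_exp:
  assumes "0 \<le> p" "p \<le> 1" "z \<le> real m"
  shows "(1 - p) ^ m \<le> exp (- p * z)"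
proof -
  have "(1 - p) ^ m \<le> exp (- p) ^ m"
    using assms exp_ge_add_one_self[of "- p"] by (intro power_mono) auto
  also have "\<dots> = exp (- (p * real m))" by (simp flip: exp_of_nat2_mult)
  also have "\<dots> \<le> exp (- p * z)" using assms by (simp add: mult_left_mono)
  finally show ?thesis .
qed

lemma prob_not_joins_large_sets:
  assumes d: "d \<ge> 3" and n: "n \<ge> 4 * d + 12" and p: "0 \<le> p" "p \<le> 1"
  shows "measure_pmf.prob (random_subset (nsets {1..n} d) p) {H. \<not> joins_large_sets {1..n} s (H \<inter> even_edges d n)}
    \<le> 4 ^ n * exp (- p * (pair_density d * (real s * (real n / 4)) * real n ^ (d - 2)))"
proof -
  let ?V = "{1..n}" and ?U = "nsets {1..n} d"
  define w where "w = exp (- p * (pair_density d * (real s * (real n / 4)) * real n ^ (d - 2)))"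
  define I where "I = {(A, B). A \<subseteq> ?V \<and> B \<subseteq> ?V \<and> A \<inter> B = {} \<and> s \<le> card A \<and> n \<le> 4 * card B}"
  define D where "D = (\<lambda>(A, B). edges_covering d n True (A \<times> B))"
  have I: "I \<subseteq> Pow ?V \<times> Pow ?V" by (auto simp: I_def)
  have "measure_pmf.prob (random_subset ?U p) {H. \<not> joins_large_sets ?V s (H \<inter> even_edges d n)} \<le> (\<Sum>i\<in>I. w)"
  proof (rule prob_union_bound[where B = "\<lambda>i. {H. {} \<subseteq> H \<and> H \<inter> D i = {}}"])
    show "finite I" by (rule finite_subset[OF I]) auto
  next
    fix H assume "H \<in> set_pmf (random_subset ?U p)" "H \<in> {H. \<not> joins_large_sets ?V s (H \<inter> even_edges d n)}"
    then obtain A B where AB: "A \<subseteq> ?V" "B \<subseteq> ?V" "A \<inter> B = {}" "s \<le> card A" "n \<le> 4 * card B"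
      "\<not> (\<exists>e\<in>H \<inter> even_edges d n. e \<inter> A \<noteq> {} \<and> e \<inter> B \<noteq> {})"
      unfolding joins_large_sets_def by auto
    have "(A, B) \<in> I" using AB by (simp add: I_def)
    moreover have "H \<inter> D (A, B) = {}" using AB(6) by (auto simp: D_def edges_covering_def)
    ultimately show "\<exists>i\<in>I. H \<in> {H. {} \<subseteq> H \<and> H \<inter> D i = {}}" by blast
  next
    fix i assume "i \<in> I"
    then obtain A B where i: "i = (A, B)" and AB: "A \<subseteq> ?V" "B \<subseteq> ?V" "A \<inter> B = {}" "s \<le> card A" "n \<le> 4 * card B"
      by (auto simp: I_def)
    have "pair_density d * real (card (A \<times> B)) * real n ^ (d - 2) \<le> real (card (D i))"
      unfolding D_def i prod.case using AB by (intro card_edges_covering[OF _ _ d n]) auto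
    moreover have "pair_density d * (real s * (real n / 4)) * real n ^ (d - 2)
        \<le> pair_density d * real (card (A \<times> B)) * real n ^ (d - 2)"
      using AB pair_density_pos[OF d] unfolding card_cartesian_product of_nat_mult
      by (intro mult_right_mono mult_left_mono mult_mono) auto
    ultimately have m: "pair_density d * (real s * (real n / 4)) * real n ^ (d - 2) \<le> real (card (D i))" by linarith
    have "measure_pmf.prob (random_subset ?U p) {H. {} \<subseteq> H \<and> H \<inter> D i = {}} \<le> p ^ card ({} :: nat set set) * (1 - p) ^ card (D i)"
      using p by (intro prob_contains_and_avoids) (auto simp: D_def edges_covering_def i)
    also have "\<dots> \<le> w" unfolding w_def using power_one_minus_le_exp[OF p m] by simp
    finally show "measure_pmf.prob (random_subset ?U p) {H. {} \<subseteq> H \<and> H \<inter> D i = {}} \<le> w" .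
  qed
  also have "\<dots> = real (card I) * w" by simp
  also have "\<dots> \<le> 4 ^ n * w"
  proof (rule mult_right_mono)
    have "card I \<le> card (Pow ?V \<times> Pow ?V)" by (intro card_mono I) auto
    also have "\<dots> = 4 ^ n" by (simp add: card_cartesian_product card_Pow flip: power_mult_distrib)
    finally show "real (card I) \<le> 4 ^ n" by (metis of_nat_le_iff of_nat_numeral of_nat_power)
  qed (simp add: w_def)
  finally show ?thesis by (simp add: w_def)
qed

definition boosters :: "nat \<Rightarrow> nat \<Rightarrow> nat set set \<Rightarrow> nat set set" where
  "boosters d n F = edges_covering d n False (far_ends (shadow F) (\<Union>F))"

lemma prob_missing_boosters:
  assumes p: "0 \<le> p" "p \<le> 1" and y: "0 < y" "y \<le> 1" and m: "z \<le> real m"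
  shows "measure_pmf.prob (random_subset (nsets {1..n} d) p)
      {H. \<exists>F. F \<subseteq> H - even_edges d n \<and> card F \<le> M \<and> m \<le> card (boosters d n (H \<inter> even_edges d n \<union> F)) \<and>
          H \<inter> boosters d n (H \<inter> even_edges d n \<union> F) = {}}
    \<le> (1 / y) ^ M * exp (y * p * real n ^ d) * exp (- p * z)"
proof -
  let ?U = "nsets {1..n} d"
  have "measure_pmf.prob (random_subset ?U p)
      {H. \<exists>F. F \<subseteq> H - even_edges d n \<and> card F \<le> M \<and> m \<le> card (boosters d n (H \<inter> even_edges d n \<union> F)) \<and>
          H \<inter> boosters d n (H \<inter> even_edges d n \<union> F) = {}}
      \<le> (1 / y) ^ M * (1 + y * p) ^ card ?U * (1 - p) ^ m"
    using p y by (intro prob_sparse_certificate) (auto simp: boosters_def edges_covering_def)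
  also have "\<dots> \<le> (1 / y) ^ M * exp (y * p * real n ^ d) * exp (- p * z)"
  proof (intro mult_mono)
    have "(1 + y * p) ^ card ?U \<le> exp (y * p) ^ card ?U" using p y by (intro power_mono) auto
    also have "\<dots> = exp (y * p * real (card ?U))" by (simp flip: exp_of_nat2_mult)
    also have "\<dots> \<le> exp (y * p * real n ^ d)"
    proof -
      have "card ?U \<le> n ^ d" using binomial_le_self_power by simp
      then have "real (card ?U) \<le> real n ^ d" by (metis of_nat_le_iff of_nat_power)
      then show ?thesis using p y by (simp add: mult_left_mono)
    qed
    finally show "(1 + y * p) ^ card ?U \<le> exp (y * p * real n ^ d)" .
    show "(1 - p) ^ m \<le> exp (- p * z)" by (rule power_one_minus_le_exp[OF p m])
  qed (use p y in auto)
  finally show ?thesis .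
qed

text \<open>
  The four error terms bound the probabilities that small sets are dense, that low-degree vertices
  are close, that the even edges fail to join large sets, and that all boosters of some sparse
  certificate are missing. The second one uses \<open>prob_not_low_degrees_apart\<close> with \<open>x = 1 / 6\<close>: close to
  the threshold a vertex then has low degree with probability at most about \<open>n powr (- 2 / 3)\<close>, and
  the square of this beats the number of chains, which is \<open>n\<close> up to powers of \<open>ln n\<close>.
\<close>
lemma prob_spanning_weak_cycle:
  assumes d: "d \<ge> 3" and n: "n \<ge> 4 * d + 12" and p: "0 \<le> p" "p \<le> 1"
    and lam: "p * real n ^ (d - 1) \<le> lam"
    and t: "lam ^ 3 * (real t / real n) ^ 4 \<le> 1" "6 * t \<le> n" and y: "0 < y" "y \<le> 1"
  shows "measure_pmf.prob (random_hypergraph d n p)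
      {H. \<exists>l v e. weak_cycle H l v e \<and> spanned_vertices l v = non_isolated H}
    \<ge> 1 - (12 / real n
      + real n * real d * (4 + real d * lam) ^ 4 * 6 ^ (2 * (21 * d)) *
          exp (- p * (5 / 6) * (2 * real ((n - 2) choose (d - 1)) - 4))
      + 4 ^ n * exp (- p * (pair_density d * (real (t div 7) * (real n / 4)) * real n ^ (d - 2)))
      + (1 / y) ^ ((21 * d + 1) * n) * exp (y * p * real n ^ d) *
          exp (- p * (pair_density d * real ((n div 4)\<^sup>2) * real n ^ (d - 2))))"
proof -
  let ?V = "{1..n}" and ?U = "nsets {1..n} d"
  let ?M = "random_subset ?U p"
  let ?P = "measure_pmf.prob ?M"
  let ?Q = "even_edges d n"
  define z where "z = pair_density d * real ((n div 4)\<^sup>2) * real n ^ (d - 2)"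
  define m where "m = nat \<lceil>z\<rceil>"
  have zm: "z \<le> real m" by (simp add: m_def) linarith
  define A1 where "A1 = {H :: nat set set. \<not> locally_sparse t H}"
  define A2 where "A2 = {H :: nat set set. \<not> low_degrees_apart (21 * d) H}"
  define A3 where "A3 = {H. \<not> joins_large_sets ?V (t div 7) (H \<inter> ?Q)}"
  define A4 where "A4 = {H. \<exists>F. F \<subseteq> H - ?Q \<and> card F \<le> (21 * d + 1) * n \<and>
     m \<le> card (boosters d n (H \<inter> ?Q \<union> F)) \<and> H \<inter> boosters d n (H \<inter> ?Q \<union> F) = {}}"
  define G where "G = {H. \<exists>l v e. weak_cycle (?V, H) l v e \<and> spanned_vertices l v = non_isolated (?V, H)}"
  have cover: "H \<in> G \<union> A1 \<union> A2 \<union> A3 \<union> A4" if "H \<in> set_pmf ?M" for H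
  proof (rule ccontr)
    assume bad: "H \<notin> G \<union> A1 \<union> A2 \<union> A3 \<union> A4"
    have HU: "H \<subseteq> ?U" using set_random_subset that by auto
    have UHV: "\<Union>H \<subseteq> ?V" using HU unfolding nsets_def by blast
    then have UH: "\<Union>H = non_isolated (?V, H)"
      unfolding non_isolated_def isolated_vertex_def verts_def hedges_def fst_conv snd_conv by blast
    have none: "\<not> (\<exists>l v e. weak_cycle (?V, H) l v e \<and> spanned_vertices l v = \<Union>H)"
      using bad unfolding UH G_def by blast
    have sparse: "locally_sparse t H" and apart: "low_degrees_apart (21 * d) H"
      and joins: "joins_large_sets ?V (t div 7) (H \<inter> ?Q)"
      using bad by (auto simp: A1_def A2_def A3_def)
    have "7 * (t div 7) \<le> t + 7" by simp
    moreover have "t div 7 \<le> card ?V div 4" using t(2) by simp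
    moreover have "?V \<noteq> {}" using n by simp
    ultimately obtain F1 where F1: "F1 \<subseteq> H - ?Q" "card F1 \<le> (21 * d + 1) * card ?V"
      "(card ?V div 4)\<^sup>2 \<le> card (far_ends (shadow (H \<inter> ?Q \<union> F1)) (\<Union>(H \<inter> ?Q \<union> F1)))"
      "\<And>u v e. (u, v) \<in> far_ends (shadow (H \<inter> ?Q \<union> F1)) (\<Union>(H \<inter> ?Q \<union> F1)) \<Longrightarrow> e \<in> H \<Longrightarrow> \<not> (u \<in> e \<and> v \<in> e)"
      using weak_cycle_or_missing_boosters[OF finite_atLeastAtMost d HU sparse apart joins _ _ _ none] by blast
    define F where "F = H \<inter> ?Q \<union> F1"
    define P where "P = far_ends (shadow F) (\<Union>F)"
    have "\<Union>F \<subseteq> ?V" using F1(1) UHV unfolding F_def by blast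
    then have PV: "P \<subseteq> ?V \<times> ?V" using far_ends_subset[of "shadow F" "\<Union>F"] unfolding P_def by blast
    have "(n div 4)\<^sup>2 \<le> card P" using F1(3) by (simp add: P_def F_def)
    then have "z \<le> pair_density d * real (card P) * real n ^ (d - 2)"
      unfolding z_def using pair_density_pos[OF d] by (intro mult_right_mono mult_left_mono) auto
    also have "\<dots> \<le> real (card (boosters d n F))"
      unfolding boosters_def P_def[symmetric]
      by (rule card_edges_covering[OF PV _ d n]) (auto simp: P_def far_ends_def)
    finally have "m \<le> card (boosters d n F)" unfolding m_def by linarith
    moreover have "H \<inter> boosters d n F = {}"
    proof -
      have False if e: "e \<in> H" "e \<in> boosters d n F" for e
      proof -
        from e(2) obtain u v where "(u, v) \<in> far_ends (shadow F) (\<Union>F)" "u \<in> e" "v \<in> e"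
          unfolding boosters_def edges_covering_def by blast
        then show False using F1(4)[of u v e] e(1) unfolding F_def by blast
      qed
      then show ?thesis by blast
    qed
    moreover have "card F1 \<le> (21 * d + 1) * n" using F1(2) by simp
    ultimately have "H \<in> A4" using F1(1) unfolding A4_def F_def by blast
    then show False using bad by blast
  qed
  have "1 = ?P UNIV" by simp
  also have "\<dots> \<le> ?P (G \<union> A1 \<union> A2 \<union> A3 \<union> A4)"
    using cover by (intro measure_pmf.finite_measure_mono_AE) (auto simp: AE_measure_pmf_iff)
  also have "\<dots> \<le> ?P G + ?P A1 + ?P A2 + ?P A3 + ?P A4"
    by (intro order_trans[OF measure_Un_le] add_mono) auto
  finally have "1 \<le> ?P G + ?P A1 + ?P A2 + ?P A3 + ?P A4" .
  moreover have "?P A1 \<le> 12 / real n"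
    unfolding A1_def using n by (intro prob_not_locally_sparse[OF d p lam t]) auto
  moreover have "?P A2 \<le> real n * real d * (4 + real d * lam) ^ 4 * 6 ^ (2 * (21 * d)) *
          exp (- p * (5 / 6) * (2 * real ((n - 2) choose (d - 1)) - 4))"
    unfolding A2_def using prob_not_low_degrees_apart[OF d p lam, of "1/6" "21 * d"] by simp
  moreover have "?P A3 \<le> 4 ^ n * exp (- p * (pair_density d * (real (t div 7) * (real n / 4)) * real n ^ (d - 2)))"
    unfolding A3_def by (rule prob_not_joins_large_sets[OF d n p])
  moreover have "?P A4 \<le> (1 / y) ^ ((21 * d + 1) * n) * exp (y * p * real n ^ d) * exp (- p * z)"
    unfolding A4_def by (rule prob_missing_boosters[OF p y zm])
  moreover have "measure_pmf.prob (random_hypergraph d n p)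
      {H. \<exists>l v e. weak_cycle H l v e \<and> spanned_vertices l v = non_isolated H} = ?P G"
    by (simp add: random_hypergraph_eq G_def vimage_def)
  ultimately show ?thesis unfolding z_def by linarith
qed

section \<open>Asymptotics\<close>

lemma power_le_fact_binomial: "(n - k) ^ k \<le> fact k * (n choose k)"
proof (induction k)
  case (Suc k)
  have "(n - Suc k) ^ Suc k = (n - Suc k) * (n - Suc k) ^ k" by simp
  also have "\<dots> \<le> (n - k) * (n - k) ^ k" by (intro mult_mono power_mono) auto
  also have "\<dots> \<le> (n - k) * (fact k * (n choose k))" by (intro mult_left_mono Suc) auto
  also have "\<dots> = fact k * ((n - k) * (n choose k))" by (simp only: mult_ac)
  also have "(n - k) * (n choose k) = Suc k * (n choose Suc k)"
    by (simp only: binomial_absorption binomial_absorb_comp)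
  finally show ?case by (simp add: algebra_simps)
qed simp

lemma error_terms_vanish:
  fixes A B D K f :: real
  assumes "A > 0" "f > 0" "D > 0"
  shows "(\<lambda>n::nat. 12 / real n) \<longlonglongrightarrow> 0"
    "(\<lambda>n::nat. real n * D * (4 + D * (2 * f * ln (real n))) ^ 4 * K * exp (10 / 3 - 4 / 3 * ln (real n))) \<longlonglongrightarrow> 0"
    "(\<lambda>n::nat. exp (real n * (ln 4 - A * (ln (real n) * (2 * f * ln (real n)) powr (- 3 / 4))))) \<longlonglongrightarrow> 0"
    "(\<lambda>n::nat. exp (real n * (D * ln (ln (real n)) + B - A * ln (real n)))) \<longlonglongrightarrow> 0"
  using assms by real_asymp+

lemma eventually_size_conditions:
  fixes B f :: real
  assumes "f > 0"
  shows "eventually (\<lambda>n::nat. 2 * f * ln (real n) / real n \<le> 1) sequentially"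
    "eventually (\<lambda>n::nat. (2 * f * ln (real n)) powr (- 3 / 4) \<le> 1 / 6) sequentially"
    "eventually (\<lambda>n::nat. real n * (2 * f * ln (real n)) powr (- 3 / 4) \<ge> 56) sequentially"
    "eventually (\<lambda>n::nat. B \<le> ln (real n)) sequentially"
  using assms by real_asymp+

lemma one_minus_over_n_power_tendsto: "(\<lambda>n::nat. (1 - D / real n) ^ k) \<longlonglongrightarrow> 1"
proof -
  have "(\<lambda>n::nat. 1 - D / real n) \<longlonglongrightarrow> 1 - 0" by (intro tendsto_intros lim_const_over_n)
  from tendsto_power[OF this, of k] show ?thesis by simp
qed

text \<open>
  It remains to choose the parameters of \<open>prob_spanning_weak_cycle\<close>. The quantity
  \<open>r = p * n ^ (d - 1)\<close> eventually lies between \<open>ln n\<close> and \<open>lam = 2 * (d - 1)! * ln n\<close>; sets count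
  as small up to
  \<open>t = n * lam powr (- 3 / 4)\<close>, and certificate edges are weighted by \<open>y = 1 / ln n\<close>.
\<close>
theorem theorem1p4:
  fixes d :: nat and c :: "nat \<Rightarrow> real" and c_lim :: real and p :: "nat \<Rightarrow> real"
  assumes "d \<ge> 3"
    and "c \<longlonglongrightarrow> c_lim"
    and "\<And>n. n \<ge> 1 \<Longrightarrow> p n = fact (d - 1) * ((ln (real n) + c n) / real n ^ (d - 1))"
  shows "(\<lambda>n. measure_pmf.prob (random_hypergraph d n (p n))
            {H. \<exists>l v e. weak_cycle H l v e \<and> spanned_vertices l v = non_isolated H})
          \<longlonglongrightarrow> 1"
proof -
  note d = assms(1)
  define f where "f = (fact (d - 1) :: real)"
  have f: "f \<ge> 2"
  proof -
    have "(fact 2 :: real) \<le> fact (d - 1)" using d by (intro fact_mono) auto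
    then show ?thesis by (simp add: f_def)
  qed
  define g where "g = pair_density d"
  have g: "g > 0" using pair_density_pos[OF d] by (simp add: g_def)
  define L where "L n = ln (real n)" for n :: nat
  define lam where "lam n = 2 * f * L n" for n
  define t where "t n = nat \<lfloor>real n * lam n powr (- 3 / 4)\<rfloor>" for n
  let ?prob = "\<lambda>n. measure_pmf.prob (random_hypergraph d n (p n))
            {H. \<exists>l v e. weak_cycle H l v e \<and> spanned_vertices l v = non_isolated H}"
  define err where "err n = 12 / real n
      + real n * real d * (4 + real d * (2 * f * ln (real n))) ^ 4 * 6 ^ (2 * (21 * d)) * exp (10 / 3 - 4 / 3 * ln (real n))
      + exp (real n * (ln 4 - g / 32 * (ln (real n) * (2 * f * ln (real n)) powr (- 3 / 4))))
      + exp (real n * (real (21 * d + 1) * ln (ln (real n)) + 2 * f - g / 64 * ln (real n)))" for n :: nat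
  have "err \<longlonglongrightarrow> 0 + 0 + 0 + 0"
    unfolding err_def using f g d by (intro tendsto_add error_terms_vanish) auto
  then have "(\<lambda>n. 1 - err n) \<longlonglongrightarrow> 1 - 0" by (intro tendsto_diff tendsto_const) simp
  then have lower: "(\<lambda>n. 1 - err n) \<longlonglongrightarrow> 1" by simp
  have "eventually (\<lambda>n. dist (c n) c_lim < 1) sequentially"
    using assms(2) by (rule tendstoD) simp
  moreover have "eventually (\<lambda>n. 20 * (\<bar>c_lim\<bar> + 1) \<le> ln (real n)) sequentially"
    by (rule eventually_size_conditions(4)[of 1]) simp
  moreover have "eventually (\<lambda>n. 9 / 10 < (1 - real (d + 1) / real n) ^ (d - 1)) sequentially"
    by (rule order_tendstoD(1)[OF one_minus_over_n_power_tendsto]) simp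
  moreover have "eventually (\<lambda>n. 2 * f * ln (real n) / real n \<le> 1) sequentially"
    "eventually (\<lambda>n. (2 * f * ln (real n)) powr (- 3 / 4) \<le> 1 / 6) sequentially"
    "eventually (\<lambda>n. real n * (2 * f * ln (real n)) powr (- 3 / 4) \<ge> 56) sequentially"
    using f by (intro eventually_size_conditions; simp)+
  moreover have "eventually (\<lambda>n. n \<ge> 4 * d + 12) sequentially" by (rule eventually_ge_at_top)
  ultimately have "eventually (\<lambda>n. 1 - err n \<le> ?prob n) sequentially"
  proof eventually_elim
    case (elim n)
    have n: "n \<ge> 4 * d + 12" and n0: "real n > 0" using elim(7) by auto
    have cn: "\<bar>c n\<bar> \<le> L n / 20" and L1: "L n \<ge> 20" using elim(1,2) by (auto simp: dist_real_def L_def)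
    have lam0: "lam n > 0" using f L1 by (simp add: lam_def)
    define q where "q = lam n powr (- 3 / 4)"
    have q: "q > 0" "q \<le> 1 / 6" "real n * q \<ge> 56"
      using lam0 elim(5,6) by (auto simp: q_def lam_def L_def)
    define r where "r = p n * real n ^ (d - 1)"
    have r: "r = f * (L n + c n)" using assms(3)[of n] n0 by (simp add: r_def f_def L_def)
    have "19 / 20 * L n \<le> L n + c n" "L n + c n \<le> 2 * L n" using cn L1 by (simp_all add: abs_le_iff)
    then have r_lo': "f * (19 / 20 * L n) \<le> r" and r_hi: "r \<le> lam n"
      unfolding r lam_def using f mult_left_mono[of _ _ f] by (simp, force simp: mult_ac)
    have "2 * (19 / 20 * L n) \<le> f * (19 / 20 * L n)" using f L1 by (intro mult_right_mono) auto
    then have r_lo: "L n \<le> r" using r_lo' L1 by linarith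
    have pr: "p n = r / real n ^ (d - 1)" using n0 by (simp add: r_def)
    have p0: "0 \<le> p n" unfolding pr using r_lo L1 n0 by simp
    have p1: "p n \<le> 1"
    proof -
      have "real n ^ 1 \<le> real n ^ (d - 1)" using n d by (intro power_increasing) auto
      then have "p n \<le> lam n / real n" unfolding pr using r_hi r_lo L1 n0 by (intro frac_le) auto
      also have "\<dots> \<le> 1" using elim(4) by (simp add: lam_def L_def)
      finally show ?thesis .
    qed
    have t_le: "real (t n) \<le> real n * q" and t_ge: "real n * q - 1 \<le> real (t n)"
      using q n0 unfolding t_def q_def[symmetric] by (simp_all add: zero_le_mult_iff)
    have t6: "6 * t n \<le> n"
    proof -
      have "real n * q \<le> real n * (1 / 6)" using q by (intro mult_left_mono) auto
      then have "real (6 * t n) \<le> real n" using t_le by simp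
      then show ?thesis by linarith
    qed
    have t4: "lam n ^ 3 * (real (t n) / real n) ^ 4 \<le> 1"
    proof -
      have "(real (t n) / real n) ^ 4 \<le> q ^ 4"
        using t_le n0 by (intro power_mono) (auto simp: field_simps)
      also have "q ^ 4 = lam n powr (- 3)"
        unfolding q_def using lam0 by (simp add: powr_powr flip: powr_realpow)
      also have "\<dots> = 1 / lam n ^ 3" using lam0 by (simp add: powr_minus_divide)
      finally have "(real (t n) / real n) ^ 4 \<le> 1 / lam n ^ 3" .
      then show ?thesis using lam0 by (simp add: pos_le_divide_eq mult.commute)
    qed
    \<comment> \<open>As \<open>n * q \<ge> 56\<close>, the two roundings turn \<open>1 / 7\<close> into at worst \<open>1 / 8\<close>.\<close>
    define s where "s = t n div 7"
    have s: "real n * q / 8 \<le> real s"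
    proof -
      have "real (t n) \<le> 7 * real s + 6" unfolding s_def by linarith
      then show ?thesis using t_ge q(3) by linarith
    qed
    have npow: "real n ^ (d - 1) = real n * real n ^ (d - 2)" "real n ^ d = real n * real n ^ (d - 1)"
    proof -
      have "d - 1 = Suc (d - 2)" "d = Suc (d - 1)" using d by auto
      then show "real n ^ (d - 1) = real n * real n ^ (d - 2)" "real n ^ d = real n * real n ^ (d - 1)"
        by (metis power_Suc)+
    qed
    have pn: "p n * (x * real n * real n ^ (d - 2)) = r * x" for x
      using npow(1) by (simp add: r_def mult_ac)
    have E2: "real n * real d * (4 + real d * lam n) ^ 4 * 6 ^ (2 * (21 * d)) *
          exp (- p n * (5 / 6) * (2 * real ((n - 2) choose (d - 1)) - 4))
        \<le> real n * real d * (4 + real d * (2 * f * ln (real n))) ^ 4 * 6 ^ (2 * (21 * d)) * exp (10 / 3 - 4 / 3 * ln (real n))"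
    proof -
      let ?C = "real ((n - 2) choose (d - 1))"
      have "real ((n - 2 - (d - 1)) ^ (d - 1)) \<le> real (fact (d - 1) * ((n - 2) choose (d - 1)))"
        by (intro of_nat_mono power_le_fact_binomial)
      moreover have "real (n - 2 - (d - 1)) = real n - real (d + 1)" using n d by linarith
      ultimately have "(real n - real (d + 1)) ^ (d - 1) \<le> f * ?C"
        unfolding of_nat_mult of_nat_power of_nat_fact f_def by simp
      moreover have "real n - real (d + 1) = real n * (1 - real (d + 1) / real n)" using n0 by (simp add: field_simps)
      ultimately have "real n ^ (d - 1) * (1 - real (d + 1) / real n) ^ (d - 1) \<le> f * ?C"
        by (simp add: power_mult_distrib)
      moreover have "real n ^ (d - 1) * (9 / 10) \<le> real n ^ (d - 1) * (1 - real (d + 1) / real n) ^ (d - 1)"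
        using elim(3) by (intro mult_left_mono) auto
      ultimately have C: "real n ^ (d - 1) * (9 / 10) \<le> f * ?C" by linarith
      \<comment> \<open>The fluctuation of \<open>c\<close> costs a factor \<open>19 / 20\<close> and the binomial coefficient a factor \<open>9 / 10\<close>; \<open>4 / 5\<close> is left.\<close>
      have "f * (19 / 20 * L n) * (9 / 10) \<le> r * (9 / 10)" using r_lo' by simp
      also have "\<dots> = p n * (real n ^ (d - 1) * (9 / 10))" by (simp add: r_def)
      also have "\<dots> \<le> p n * (f * ?C)" using C p0 by (rule mult_left_mono)
      finally have "f * (171 / 200 * L n) \<le> f * (p n * ?C)" by (simp add: mult_ac)
      then have "171 / 200 * L n \<le> p n * ?C" using f by (simp add: mult_le_cancel_left_pos)
      then have "4 / 5 * L n \<le> p n * ?C" using L1 by linarith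
      then have "- p n * (5 / 6) * (2 * ?C - 4) \<le> 10 / 3 - 4 / 3 * L n"
        using p1 by (simp add: algebra_simps)
      then show ?thesis unfolding lam_def L_def by (intro mult_left_mono) auto
    qed
    have E3: "4 ^ n * exp (- p n * (g * (real s * (real n / 4)) * real n ^ (d - 2)))
        \<le> exp (real n * (ln 4 - g / 32 * (ln (real n) * (2 * f * ln (real n)) powr (- 3 / 4))))"
    proof -
      have "L n * (g * (real n * q / 8) / 4) \<le> r * (g * real s / 4)"
        using r_lo s g q L1 by (intro mult_mono divide_right_mono mult_left_mono) auto
      also have "\<dots> = p n * (g * (real s * (real n / 4)) * real n ^ (d - 2))"
        using pn[of "g * real s / 4"] by (auto simp: mult_ac)
      finally have "exp (real n * ln 4 - p n * (g * (real s * (real n / 4)) * real n ^ (d - 2)))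
          \<le> exp (real n * ln 4 - L n * (g * (real n * q / 8) / 4))" by simp
      moreover have "4 ^ n * exp (- p n * (g * (real s * (real n / 4)) * real n ^ (d - 2)))
          = exp (real n * ln 4 - p n * (g * (real s * (real n / 4)) * real n ^ (d - 2)))"
      proof -
        have four: "(4::real) ^ n = exp (real n * ln 4)" by (simp add: exp_of_nat_mult)
        show ?thesis unfolding four exp_add[symmetric] by simp
      qed
      moreover have "real n * ln 4 - L n * (g * (real n * q / 8) / 4) = real n * (ln 4 - g / 32 * (L n * q))"
        by (simp add: field_simps)
      ultimately have "4 ^ n * exp (- p n * (g * (real s * (real n / 4)) * real n ^ (d - 2)))
          \<le> exp (real n * (ln 4 - g / 32 * (L n * q)))" by (simp only:)
      then show ?thesis by (simp only: q_def lam_def L_def)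
    qed
    have E4: "(1 / (1 / L n)) ^ ((21 * d + 1) * n) * exp (1 / L n * p n * real n ^ d) *
          exp (- p n * (g * real ((n div 4)\<^sup>2) * real n ^ (d - 2)))
        \<le> exp (real n * (real (21 * d + 1) * ln (ln (real n)) + 2 * f - g / 64 * ln (real n)))"
    proof -
      have "(1 / (1 / L n)) ^ ((21 * d + 1) * n) = exp (real ((21 * d + 1) * n) * ln (L n))"
        using L1 by (subst exp_of_nat_mult) simp
      moreover have "1 / L n * p n * real n ^ d \<le> real n * (2 * f)"
      proof -
        have "1 / L n * p n * real n ^ d = real n * (r / L n)" by (simp add: npow(2) r_def)
        also have "\<dots> \<le> real n * (2 * f)"
          using r_hi L1 by (intro mult_left_mono) (auto simp: lam_def divide_le_eq)
        finally show ?thesis .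
      qed
      moreover have "L n * (g * (real n / 64)) \<le> p n * (g * real ((n div 4)\<^sup>2) * real n ^ (d - 2))"
      proof -
        have "real n / 8 \<le> real (n div 4)" using n by linarith
        then have "(real n / 8)\<^sup>2 \<le> real (n div 4) ^ 2" by (intro power_mono) auto
        then have sq: "real n * (real n / 64) \<le> real ((n div 4)\<^sup>2)" by (simp add: power2_eq_square)
        have "L n * (g * (real n / 64)) \<le> r * (g * (real n / 64))"
          using r_lo g by (intro mult_right_mono) auto
        also have "\<dots> = p n * (g * (real n * (real n / 64)) * real n ^ (d - 2))"
          using pn[of "g * (real n / 64)"] by (auto simp: mult_ac)
        also have "\<dots> \<le> p n * (g * real ((n div 4)\<^sup>2) * real n ^ (d - 2))"
          using sq g p0 by (intro mult_left_mono mult_right_mono) auto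
        finally show ?thesis .
      qed
      ultimately have "(1 / (1 / L n)) ^ ((21 * d + 1) * n) * exp (1 / L n * p n * real n ^ d) *
          exp (- p n * (g * real ((n div 4)\<^sup>2) * real n ^ (d - 2)))
        \<le> exp (real ((21 * d + 1) * n) * ln (L n)) * exp (real n * (2 * f)) * exp (- (L n * (g * (real n / 64))))"
        by (intro mult_mono) auto
      also have "\<dots> = exp (real ((21 * d + 1) * n) * ln (L n) + real n * (2 * f) - L n * (g * (real n / 64)))"
        unfolding exp_add[symmetric] by simp
      also have "real ((21 * d + 1) * n) * ln (L n) + real n * (2 * f) - L n * (g * (real n / 64))
          = real n * (real (21 * d + 1) * ln (L n) + 2 * f - g / 64 * L n)"
        by (simp add: field_simps)
      finally show ?thesis by (simp add: L_def)
    qed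
    have "1 - (12 / real n
      + real n * real d * (4 + real d * lam n) ^ 4 * 6 ^ (2 * (21 * d)) *
          exp (- p n * (5 / 6) * (2 * real ((n - 2) choose (d - 1)) - 4))
      + 4 ^ n * exp (- p n * (g * (real s * (real n / 4)) * real n ^ (d - 2)))
      + (1 / (1 / L n)) ^ ((21 * d + 1) * n) * exp (1 / L n * p n * real n ^ d) *
          exp (- p n * (g * real ((n div 4)\<^sup>2) * real n ^ (d - 2)))) \<le> ?prob n"
      unfolding g_def s_def using L1
      by (intro prob_spanning_weak_cycle[OF d n p0 p1 _ t4 t6]) (use r_hi in \<open>auto simp: r_def\<close>)
    then show ?case using E2 E3 E4 unfolding err_def by linarith
  qed
  then show ?thesis
    by (intro tendsto_sandwich[OF _ _ lower tendsto_const]) auto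
qed

end
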